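(* Let $1<p<\infty$. Let $\Omega=\{z=x+iy\in\mathbb{C}:0<x<1,\ 0<y<1\}$, let $\mathbb{C}^{++}=\{z\in\mathbb{C}:\operatorname{Re}(z)>0,\ \operatorname{Im}(z)>0\}$ and $(1+i)-\mathbb{C}^{++}=\{(1+i)-z:z\in\mathbb{C}^{++}\}$, so that $\Omega=\mathbb{C}^{++}\cap\big((1+i)-\mathbb{C}^{++}\big)$. Then $$A^p(\Omega)=A^p(\mathbb{C}^{++})+A^p\big((1+i)-\mathbb{C}^{++}\big).$$
   Context: For an open set $U\subset\mathbb{C}$ and $1\le p<\infty$, the Bergman space $A^p(U)$ consists of all holomorphic functions $f$ on $U$ with $\int_U |f(x+iy)|^p\,dx\,dy<+\infty$. The sum on the right-hand side is the set of functions on $\Omega$ of the form $f_1|_\Omega+f_2|_\Omega$ with $f_1\in A^p(\mathbb{C}^{++})$ and $f_2\in A^p((1+i)-\mathbb{C}^{++})$. *)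

theory Defs
  imports "HOL-Analysis.Analysis"
begin

text \<open>
  Functions on U are represented by total functions that are
  \<^term>\<open>undefined\<close> outside U, so that equality in \<^term>\<open>extensional U\<close> is
  equality of functions on U. Lebesgue measure on the complex plane is
  \<^term>\<open>lborel :: complex measure\<close>, which is the measure dx dy in the
  coordinates z = x + iy.
\<close>

definition bergman :: "real \<Rightarrow> complex set \<Rightarrow> (complex \<Rightarrow> complex) set" where
  "bergman p U = {f \<in> extensional U. f holomorphic_on U \<and>
     (\<integral>\<^sup>+z\<in>U. ennreal (cmod (f z) powr p) \<partial>lborel) < \<infinity>}"

definition sum_on ::
  "complex set \<Rightarrow> (complex \<Rightarrow> complex) set \<Rightarrow> (complex \<Rightarrow> complex) set \<Rightarrow> (complex \<Rightarrow> complex) set" where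
  "sum_on W F G = {restrict (\<lambda>z. f z + g z) W | f g. f \<in> F \<and> g \<in> G}"

definition open_unit_square :: "complex set" where
  "open_unit_square = {z. 0 < Re z \<and> Re z < 1 \<and> 0 < Im z \<and> Im z < 1}"

definition open_quadrant :: "complex set" where
  "open_quadrant = {z. Re z > 0 \<and> Im z > 0}"

definition opposite_quadrant :: "complex set" where
  "opposite_quadrant = {(1 + \<i>) - z | z. z \<in> open_quadrant}"

lemma opposite_quadrant_iff: "z \<in> opposite_quadrant \<longleftrightarrow> Re z < 1 \<and> Im z < 1"
proof
  assume "z \<in> opposite_quadrant"
  then show "Re z < 1 \<and> Im z < 1"
    by (auto simp: opposite_quadrant_def open_quadrant_def)
next
  assume "Re z < 1 \<and> Im z < 1"
  then have "(1 + \<i>) - z \<in> open_quadrant" and "z = (1 + \<i>) - ((1 + \<i>) - z)"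
    by (simp_all add: open_quadrant_def)
  then show "z \<in> opposite_quadrant"
    unfolding opposite_quadrant_def by blast
qed

lemma open_unit_square_eq_Int: "open_unit_square = open_quadrant \<inter> opposite_quadrant"
  by (auto simp: opposite_quadrant_iff open_unit_square_def open_quadrant_def)

end

theory Submission
  imports Defs "HOL-Complex_Analysis.Complex_Analysis"
begin

text \<open>
  For \<open>f\<close> holomorphic on the closed square, split the Cauchy integral over the boundary at the corners
  \<open>1\<close> and \<open>\<i>\<close>: the two lower sides give a function on the first quadrant, the two upper sides a
  function on the opposite one. A modified Cauchy kernel \<open>K\<close>, which vanishes at both corners, makes
  this splitting bounded on \<open>L\<^sup>p\<close>. Indeed either contour may be deformed to a curve from \<open>1\<close> to \<open>\<i>\<close>
  inside the square that meets the boundary only at these corners. Choosing the curve, depending on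
  the point \<open>z\<close>, at a distance from \<open>z\<close> comparable to the distance to the corner, and averaging over
  such curves, one bounds the pieces by \<open>\<bar>f z\<bar>\<close> and the area integrals of
  \<open>\<bar>f w\<bar> / (\<bar>z - c\<bar> + \<bar>w - c\<bar>)\<^sup>2\<close> for the two corners \<open>c\<close>, which Schur's test controls.
  A general \<open>f\<close> is approximated by its dilations \<open>f\<^sub>r\<close> about the centre of the square; Montel's
  theorem and Fatou's lemma pass the decomposition to the limit.
\<close>

subsection \<open>Schur test for a homogeneous kernel in the plane\<close>

text \<open>An \<open>L\<^sup>p\<close> bound on \<open>f\<close> gives no control on a single
  curve, hence the averaging over slopes. It is legitimate because contours that do not cross
  \<open>z\<close> give the same value, and crossing \<open>z\<close> changes it by
  \<open>f z\<close>. On the curve of slope \<open>t\<close> through the corner \<open>c\<close>,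
  the point \<open>w\<close> with parameter \<open>s\<close> has area element
  \<open>s ds dt\<close>, and \<open>cmod (w - c)\<close> is comparable to \<open>s\<close>. With
  the plain kernel \<open>1 / (w - z)\<close> the average would thus be controlled by the kernel
  \<open>1 / (cmod (w - c) * (cmod (z - c) + cmod (w - c)))\<close>, which is bounded on
  \<open>L\<^sup>p\<close> only for \<open>p > 2\<close>. The zero of \<open>corner_factor z\<close>
  at \<open>c\<close>, divided by its denominator near \<open>c\<close>, replaces the singular
  factor by a second \<open>cmod (z - c) + cmod (w - c)\<close>. The result is homogeneous of degree
  -2 and bounded for every \<open>p > 1\<close>.\<close>

lemma measurable_Complex [measurable]:
  "(\<lambda>(x, y). Complex x y) \<in> borel_measurable (borel \<Otimes>\<^sub>M borel)"
proof -
  have "(\<lambda>q::real \<times> real. Complex (fst q) (snd q)) \<in> borel_measurable borel"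
    by (intro borel_measurable_continuous_onI) (simp add: Complex_eq, intro continuous_intros)
  then show ?thesis
    by (simp add: borel_prod case_prod_unfold)
qed

lemma lborel_complex_eq_distr:
  "(lborel :: complex measure) = distr (lborel \<Otimes>\<^sub>M lborel) borel (\<lambda>(x, y). Complex x y)"
proof (rule lborel_eqI)
  fix l u :: complex
  assume *: "\<And>b. b \<in> Basis \<Longrightarrow> l \<bullet> b \<le> u \<bullet> b"
  have le: "Re l \<le> Re u" "Im l \<le> Im u"
    using *[of 1] *[of \<i>] by (simp_all add: Basis_complex_def inner_complex_def)
  have vimage: "(\<lambda>(x, y). Complex x y) -` box l u = {Re l<..<Re u} \<times> {Im l<..<Im u}"
    by (auto simp: in_box_complex_iff)
  have "emeasure (distr (lborel \<Otimes>\<^sub>M lborel) borel (\<lambda>(x, y). Complex x y)) (box l u) =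
      emeasure (lborel \<Otimes>\<^sub>M lborel) ({Re l<..<Re u} \<times> {Im l<..<Im u})"
    by (subst emeasure_distr) (simp_all add: vimage space_pair_measure)
  also have "\<dots> = ennreal (Re u - Re l) * ennreal (Im u - Im l)"
    using le by (simp add: lborel.emeasure_pair_measure_Times)
  also have "\<dots> = (\<Prod>b\<in>Basis. (u - l) \<bullet> b)"
    using le by (simp add: Basis_complex_def inner_complex_def ennreal_mult complex_eq_iff)
  finally show "emeasure (distr (lborel \<Otimes>\<^sub>M lborel) borel (\<lambda>(x, y). Complex x y)) (box l u) =
      (\<Prod>b\<in>Basis. (u - l) \<bullet> b)" .
qed simp

lemma nn_integral_lborel_complex:
  assumes [measurable]: "f \<in> borel_measurable borel"
  shows "(\<integral>\<^sup>+z. f z \<partial>(lborel :: complex measure)) = (\<integral>\<^sup>+x. \<integral>\<^sup>+y. f (Complex x y) \<partial>lborel \<partial>lborel)"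
proof -
  have "(\<integral>\<^sup>+z. f z \<partial>(lborel :: complex measure)) =
      (\<integral>\<^sup>+q. f (case q of (x, y) \<Rightarrow> Complex x y) \<partial>(lborel \<Otimes>\<^sub>M lborel))"
    by (subst lborel_complex_eq_distr, subst nn_integral_distr) simp_all
  also have "\<dots> = (\<integral>\<^sup>+x. \<integral>\<^sup>+y. f (Complex x y) \<partial>lborel \<partial>lborel)"
    by (subst lborel.nn_integral_fst[symmetric]) simp_all
  finally show ?thesis .
qed

lemma nn_integral_lborel_translate:
  fixes c :: complex
  assumes [measurable]: "f \<in> borel_measurable borel"
  shows "(\<integral>\<^sup>+z. f (z - c) \<partial>lborel) = (\<integral>\<^sup>+z. f z \<partial>lborel)"
proof -
  have "(\<integral>\<^sup>+z. f (z - c) \<partial>lborel) = (\<integral>\<^sup>+z. f (c + z - c) \<partial>lborel)"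
    by (subst lborel_distr_plus[of c, symmetric], subst nn_integral_distr) simp_all
  then show ?thesis by simp
qed

text \<open>The summands come from the ranges \<bar>x\<bar> \<le> a and \<bar>x\<bar> \<ge> a of the
  integral below, the factor 2 from its symmetry in \<open>x\<close>.\<close>

definition powr_kernel_const :: "real \<Rightarrow> real" where
  "powr_kernel_const c = 2 * (1 / (1 - c) + 1 / c)"

text \<open>For \<bar>x\<bar> \<le> a the denominator is replaced by \<open>a\<close>, beyond that
  by \<bar>x\<bar>. The remaining power integrals converge because \<open>c < 1\<close> and
  \<open>0 < c\<close> respectively, and by homogeneity both are multiples of
  \<open>a powr (-c)\<close>.\<close>

lemma nn_integral_powr_kernel_real:
  fixes a c :: real
  assumes "0 < c" "c < 1" "0 < a"
  shows "(\<integral>\<^sup>+x. ennreal (\<bar>x\<bar> powr (-c) / (\<bar>x\<bar> + a)) \<partial>lborel) \<le> ennreal (powr_kernel_const c * a powr (-c))"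
proof -
  let ?f = "\<lambda>x::real. ennreal (\<bar>x\<bar> powr (-c) / (\<bar>x\<bar> + a))"
  have near: "(\<integral>\<^sup>+x. ennreal (x powr (-c) / a) * indicator {0..a} x \<partial>lborel) = ennreal (a powr (-c) / (1 - c))"
  proof (rule nn_integral_has_integral_lebesgue')
    have "((\<lambda>x. x powr (-c) / a) has_integral (a powr (-c + 1) / (-c + 1)) / a) {0..a}"
      using has_integral_powr_from_0[of "-c" a] assms by (intro has_integral_divide) auto
    also have "(a powr (-c + 1) / (-c + 1)) / a = a powr (-c) / (1 - c)"
    proof -
      have "a powr (-c + 1) = a powr (-c) * a" using assms by (subst powr_add) simp
      then show ?thesis using assms by simp
    qed
    finally show "((\<lambda>x. x powr (-c) / a) has_integral a powr (-c) / (1 - c)) {0..a}" .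
  qed (use assms in auto)
  have far: "(\<integral>\<^sup>+x. ennreal (x powr (-c - 1)) * indicator {a..} x \<partial>lborel) = ennreal (a powr (-c) / c)"
  proof (rule nn_integral_has_integral_lebesgue')
    show "((\<lambda>x. x powr (-c - 1)) has_integral a powr (-c) / c) {a..}"
      using has_integral_powr_to_inf[of "-c - 1" a] assms by simp
  qed (use assms in auto)
  have half: "(\<integral>\<^sup>+x. ?f x * indicator {0..} x \<partial>lborel) \<le> ennreal ((1 / (1 - c) + 1 / c) * a powr (-c))"
  proof -
    have "?f x * indicator {0..} x \<le>
        ennreal (x powr (-c) / a) * indicator {0..a} x + ennreal (x powr (-c - 1)) * indicator {a..} x" for x
    proof -
      consider "x < 0" | "0 \<le> x" "x \<le> a" | "a < x" by linarith
      then show ?thesis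
      proof cases
        case 2
        then have "\<bar>x\<bar> powr (-c) / (\<bar>x\<bar> + a) \<le> x powr (-c) / a"
          using assms by (auto intro!: divide_left_mono)
        then show ?thesis using 2
          by (simp add: ennreal_leI add_increasing2)
      next
        case 3
        have "x powr (-c - 1) = x powr (-c) / x"
          using 3 assms by (simp add: powr_diff)
        then have "\<bar>x\<bar> powr (-c) / (\<bar>x\<bar> + a) \<le> x powr (-c - 1)"
          using 3 assms by (auto intro!: divide_left_mono)
        then show ?thesis using 3 assms
          by (simp add: ennreal_leI)
      qed auto
    qed
    then have "(\<integral>\<^sup>+x. ?f x * indicator {0..} x \<partial>lborel) \<le>
        (\<integral>\<^sup>+x. ennreal (x powr (-c) / a) * indicator {0..a} x + ennreal (x powr (-c - 1)) * indicator {a..} x \<partial>lborel)"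
      by (intro nn_integral_mono)
    also have "\<dots> = ennreal (a powr (-c) / (1 - c)) + ennreal (a powr (-c) / c)"
      by (subst nn_integral_add) (simp_all add: near far)
    also have "\<dots> = ennreal ((1 / (1 - c) + 1 / c) * a powr (-c))"
      using assms by (subst ennreal_plus[symmetric]) (auto simp: algebra_simps)
    finally show ?thesis .
  qed
  have neg: "(\<integral>\<^sup>+x. ?f x * indicator {..0} x \<partial>lborel) = (\<integral>\<^sup>+x. ?f x * indicator {0..} x \<partial>lborel)"
    by (subst nn_integral_real_affine[where c = "-1" and t = 0])
       (auto intro!: nn_integral_cong simp: indicator_def)
  have "(\<integral>\<^sup>+x. ?f x \<partial>lborel) \<le> (\<integral>\<^sup>+x. ?f x * indicator {..0} x + ?f x * indicator {0..} x \<partial>lborel)"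
    by (intro nn_integral_mono) (auto simp: indicator_def)
  also have "\<dots> = (\<integral>\<^sup>+x. ?f x * indicator {..0} x \<partial>lborel) + (\<integral>\<^sup>+x. ?f x * indicator {0..} x \<partial>lborel)"
    by (intro nn_integral_add) simp_all
  also have "\<dots> \<le> ennreal ((1 / (1 - c) + 1 / c) * a powr (-c)) + ennreal ((1 / (1 - c) + 1 / c) * a powr (-c))"
    unfolding neg by (intro add_mono half)
  also have "\<dots> = ennreal (powr_kernel_const c * a powr (-c))"
    using assms by (subst ennreal_plus[symmetric]) (auto simp: powr_kernel_const_def algebra_simps)
  finally show ?thesis .
qed

lemma AE_lborel_neq: "AE x in lborel. x \<noteq> (c :: 'a :: euclidean_space)"
  by (rule AE_I'[of "{c}"]) (auto simp: null_sets_def)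

text \<open>Since \<open>cmod z\<close> dominates both coordinates, the planar integral is bounded by the square of
  a one-dimensional one, which avoids polar coordinates.\<close>

lemma nn_integral_powr_kernel_complex:
  fixes a d :: real and c :: complex
  assumes "0 < d" "d < 2" "0 < a"
  shows "(\<integral>\<^sup>+z. ennreal (cmod (z - c) powr (-d) / (cmod (z - c) + a)\<^sup>2) \<partial>lborel) \<le>
    ennreal ((powr_kernel_const (d / 2))\<^sup>2 * a powr (-d))"
proof -
  let ?k = "\<lambda>x::real. \<bar>x\<bar> powr (-(d / 2)) / (\<bar>x\<bar> + a)"
  let ?C = "powr_kernel_const (d / 2) * a powr (-(d / 2))"
  have C: "0 \<le> ?C" using assms by (simp add: powr_kernel_const_def)
  \<comment> \<open>The axes must be excluded: \<open>0 powr (-(d / 2))\<close> is 0, so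
    \<open>?k\<close> vanishes at 0 while the left side need not.\<close>
  have pt: "ennreal (cmod (Complex x y) powr (-d) / (cmod (Complex x y) + a)\<^sup>2) \<le> ennreal (?k x) * ennreal (?k y)"
    if "x \<noteq> 0" "y \<noteq> 0" for x y
  proof -
    let ?r = "cmod (Complex x y)"
    have r: "\<bar>x\<bar> \<le> ?r" "\<bar>y\<bar> \<le> ?r"
      using abs_Re_le_cmod[of "Complex x y"] abs_Im_le_cmod[of "Complex x y"] by simp_all
    have le: "?r powr (-(d / 2)) / (?r + a) \<le> ?k x" "?r powr (-(d / 2)) / (?r + a) \<le> ?k y"
      using r assms that by (auto intro!: frac_le powr_mono2' simp: complex_eq_iff)
    have "?r powr (-d) / (?r + a)\<^sup>2 = (?r powr (-(d / 2)) / (?r + a)) * (?r powr (-(d / 2)) / (?r + a))"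
      by (simp add: power2_eq_square powr_add[symmetric])
    also have "\<dots> \<le> ?k x * ?k y"
      using le assms by (intro mult_mono) auto
    finally show ?thesis
      using assms by (simp add: ennreal_mult[symmetric] ennreal_leI)
  qed
  have "(\<integral>\<^sup>+z. ennreal (cmod (z - c) powr (-d) / (cmod (z - c) + a)\<^sup>2) \<partial>lborel) =
      (\<integral>\<^sup>+z. ennreal (cmod z powr (-d) / (cmod z + a)\<^sup>2) \<partial>lborel)"
    by (rule nn_integral_lborel_translate) simp
  also have "\<dots> = (\<integral>\<^sup>+x. \<integral>\<^sup>+y. ennreal (cmod (Complex x y) powr (-d) / (cmod (Complex x y) + a)\<^sup>2) \<partial>lborel \<partial>lborel)"
    by (rule nn_integral_lborel_complex) simp
  also have "\<dots> \<le> (\<integral>\<^sup>+x. \<integral>\<^sup>+y. ennreal (?k x) * ennreal (?k y) \<partial>lborel \<partial>lborel)"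
  proof (rule nn_integral_mono_AE, use AE_lborel_neq[of "0::real"] in eventually_elim)
    case (elim x)
    show ?case
      by (rule nn_integral_mono_AE, use AE_lborel_neq[of "0::real"] in eventually_elim) (rule pt[OF elim])
  qed
  also have "\<dots> = (\<integral>\<^sup>+x. ennreal (?k x) \<partial>lborel) * (\<integral>\<^sup>+y. ennreal (?k y) \<partial>lborel)"
    by (simp add: nn_integral_cmult nn_integral_multc)
  also have "\<dots> \<le> ennreal ?C * ennreal ?C"
    using assms by (intro mult_mono nn_integral_powr_kernel_real) auto
  also have "\<dots> = ennreal ((powr_kernel_const (d / 2))\<^sup>2 * a powr (-d))"
  proof -
    have "?C * ?C = (powr_kernel_const (d / 2))\<^sup>2 * (a powr (-(d / 2)) * a powr (-(d / 2)))"
      by (simp add: power2_eq_square)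
    also have "a powr (-(d / 2)) * a powr (-(d / 2)) = a powr (-d)"
      by (simp add: powr_add[symmetric])
    finally show ?thesis using C by (simp add: ennreal_mult[symmetric])
  qed
  finally show ?thesis .
qed

text \<open>Optimising over the scale \<open>L\<close> replaces Hoelder's inequality in Schur's test.\<close>

lemma ennreal_powr_le_of_scaled_bounds:
  fixes a p y :: real and X :: ennreal
  assumes "1 < p" "0 \<le> a" "0 < y"
    and bound: "\<And>L. 0 < L \<Longrightarrow> ennreal a \<le> ennreal (L powr (1 - p)) * X + ennreal (L * y)"
  shows "ennreal (a powr p) \<le> ennreal (2 powr p * y powr (p - 1)) * X"
proof (cases X)
  case top
  then show ?thesis using assms by (simp add: ennreal_mult_top)
next
  case (real x)
  have le: "a \<le> L powr (1 - p) * x + L * y" if "0 < L" for L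
  proof -
    have "ennreal a \<le> ennreal (L powr (1 - p) * x + L * y)"
      using bound[OF that] real that assms by (simp add: ennreal_mult[symmetric] ennreal_plus[symmetric] del: ennreal_plus)
    then show ?thesis using real that assms by (subst (asm) ennreal_le_iff) auto
  qed
  show ?thesis
  proof (cases "x = 0")
    case True
    have "a = 0"
    proof (rule ccontr)
      assume "a \<noteq> 0"
      then have "0 < a / (2 * y)" using assms by simp
      from le[OF this] show False using True \<open>a \<noteq> 0\<close> assms by simp
    qed
    then show ?thesis by simp
  next
    case False
    then have x: "0 < x" using real by simp
    \<comment> \<open>This scale makes the two terms \<open>L powr (1 - p) * x\<close> and
      \<open>L * y\<close> equal.\<close>
    define L where "L = (x / y) powr (1 / p)"
    have L: "0 < L" using x assms by (simp add: L_def)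
    have Lp: "L powr p = x / y" using x assms by (simp add: L_def powr_powr)
    have "L powr (1 - p) * x = L * y"
      using L Lp x assms by (simp add: powr_diff)
    then have "a \<le> 2 * (L * y)" using le[OF L] by simp
    then have "a powr p \<le> (2 * (L * y)) powr p"
      using assms by (intro powr_mono2) auto
    also have "\<dots> = 2 powr p * ((x / y) * y powr p)"
      using L assms by (simp add: powr_mult Lp)
    also have "\<dots> = 2 powr p * y powr (p - 1) * x"
      using assms by (simp add: powr_diff)
    finally show ?thesis using real assms
      by (simp add: ennreal_mult[symmetric] ennreal_leI)
  qed
qed

text \<open>The factor \<open>2 powr p\<close> is the cost of optimising the scale; the other two
  are the kernel integrals against the weights with exponents \<open>1 / p\<close> and
  \<open>1 - 1 / p\<close>. The \<open>+ 1\<close> keeps the base positive, as the optimisation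
  divides by it.\<close>

definition schur_const :: "real \<Rightarrow> real" where
  "schur_const p = 2 powr p * ((powr_kernel_const (1 / p / 2))\<^sup>2 + 1) powr (p - 1) *
     (powr_kernel_const ((1 - 1 / p) / 2))\<^sup>2"

text \<open>Schur's test with weights \<open>cmod (w - c) powr (-1 / p)\<close>.\<close>

lemma schur_test_homogeneous_kernel:
  fixes h a :: "complex \<Rightarrow> real" and c :: complex
  assumes p: "1 < p" and [measurable]: "h \<in> borel_measurable borel" "D \<in> sets borel"
    and h: "\<And>w. 0 \<le> h w" and a: "\<And>z. 0 \<le> a z"
    and bound: "\<And>z. z \<in> D \<Longrightarrow> ennreal (a z) \<le> (\<integral>\<^sup>+w. ennreal (h w / (cmod (z - c) + cmod (w - c))\<^sup>2) \<partial>lborel)"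
  shows "(\<integral>\<^sup>+z\<in>D. ennreal (a z powr p) \<partial>lborel) \<le> ennreal (schur_const p) * (\<integral>\<^sup>+w. ennreal (h w powr p) \<partial>lborel)"
proof -
  \<comment> \<open>Schur's test needs one exponent for the integral in \<open>w\<close> and, after
    taking powers, \<open>b * (p - 1)\<close> for the integral in \<open>z\<close>. Both must lie
    strictly between 0 and 2; \<open>b = 1 / p\<close> achieves this for every
    \<open>p > 1\<close>.\<close>
  define b where "b = 1 / p"
  define d where "d = 1 - 1 / p"
  have bd: "0 < b" "b < 2" "0 < d" "d < 2" "b * (p - 1) = d"
    using p by (auto simp: b_def d_def field_simps)
  define K where "K = (powr_kernel_const (b / 2))\<^sup>2 + 1"
  define K' where "K' = (powr_kernel_const (d / 2))\<^sup>2"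
  have K: "0 < K" "0 \<le> K'" by (simp_all add: K_def K'_def add_nonneg_pos)
  have const: "schur_const p = 2 powr p * K powr (p - 1) * K'"
    by (simp add: schur_const_def K_def K'_def b_def d_def)
  let ?k = "\<lambda>z w. 1 / (cmod (z - c) + cmod (w - c))\<^sup>2"
  let ?X = "\<lambda>z. \<integral>\<^sup>+w. ennreal (h w powr p * cmod (w - c) powr d * ?k z w) \<partial>lborel"
  have pt: "ennreal (a z powr p) \<le> ennreal (2 powr p * K powr (p - 1)) * (ennreal (cmod (z - c) powr (-d)) * ?X z)"
    if "z \<in> D" "z \<noteq> c" for z
  proof -
    let ?r = "cmod (z - c)"
    have r: "0 < ?r" using that by simp
    define y where "y = K * ?r powr (-b)"
    have y: "0 < y" using K r by (simp add: y_def)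
    have "ennreal (a z powr p) \<le> ennreal (2 powr p * y powr (p - 1)) * ?X z"
    proof (rule ennreal_powr_le_of_scaled_bounds[OF p a y])
      fix L :: real assume L: "0 < L"
      have le: "ennreal (h w * ?k z w) \<le> ennreal (L powr (1 - p)) * ennreal (h w powr p * cmod (w - c) powr d * ?k z w) +
          ennreal L * ennreal (cmod (w - c) powr (-b) * ?k z w)" if "w \<noteq> c" for w
      proof -
        \<comment> \<open>The scale \<open>L\<close> times the Schur weight. If \<open>h w\<close>
          exceeds \<open>l\<close>, then \<open>h w powr (1 - p) \<le> l powr (1 - p)\<close>, since
          the exponent is negative; otherwise \<open>h w \<le> l\<close> already suffices. This
          replaces Young's inequality.\<close>
        define l where "l = L * cmod (w - c) powr (-b)"
        have l: "0 < l" using L that by (simp add: l_def)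
        have lp: "l powr (1 - p) = L powr (1 - p) * cmod (w - c) powr d"
        proof -
          have "-b * (1 - p) = d" using bd by (simp add: algebra_simps)
          then show ?thesis using L by (simp add: l_def powr_mult powr_powr)
        qed
        have "h w \<le> l powr (1 - p) * h w powr p + l"
        proof (cases "h w \<le> l")
          case True
          then show ?thesis by (simp add: add_increasing)
        next
          case False
          have "h w = h w powr (1 - p) * h w powr p"
            using False l by (simp add: powr_add[symmetric])
          also have "\<dots> \<le> l powr (1 - p) * h w powr p"
            using False l p by (intro mult_right_mono powr_mono2') auto
          finally show ?thesis using l by simp
        qed
        then have "h w * ?k z w \<le> (L powr (1 - p) * cmod (w - c) powr d * h w powr p + L * cmod (w - c) powr (-b)) * ?k z w"
          unfolding lp unfolding l_def by (intro mult_right_mono) auto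
        also have "\<dots> = L powr (1 - p) * (h w powr p * cmod (w - c) powr d * ?k z w) + L * (cmod (w - c) powr (-b) * ?k z w)"
          by (simp add: algebra_simps add_divide_distrib)
        finally show ?thesis
          using L by (simp add: ennreal_mult[symmetric] ennreal_plus[symmetric] ennreal_leI del: ennreal_plus)
      qed
      have "ennreal (a z) \<le> (\<integral>\<^sup>+w. ennreal (h w * ?k z w) \<partial>lborel)"
        using bound[OF \<open>z \<in> D\<close>] by simp
      also have "\<dots> \<le> (\<integral>\<^sup>+w. ennreal (L powr (1 - p)) * ennreal (h w powr p * cmod (w - c) powr d * ?k z w) +
          ennreal L * ennreal (cmod (w - c) powr (-b) * ?k z w) \<partial>lborel)"
        by (rule nn_integral_mono_AE, use AE_lborel_neq[of c] in eventually_elim) (rule le)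
      also have "\<dots> = ennreal (L powr (1 - p)) * ?X z + ennreal L * (\<integral>\<^sup>+w. ennreal (cmod (w - c) powr (-b) * ?k z w) \<partial>lborel)"
        by (subst nn_integral_add) (simp_all add: nn_integral_cmult)
      also have "(\<integral>\<^sup>+w. ennreal (cmod (w - c) powr (-b) * ?k z w) \<partial>lborel) \<le> ennreal y"
      proof -
        have "(\<integral>\<^sup>+w. ennreal (cmod (w - c) powr (-b) * ?k z w) \<partial>lborel) \<le> ennreal ((powr_kernel_const (b / 2))\<^sup>2 * ?r powr (-b))"
          using nn_integral_powr_kernel_complex[OF bd(1,2) r, of c] by (simp add: add.commute)
        also have "\<dots> \<le> ennreal y"
          unfolding y_def K_def by (intro ennreal_leI mult_right_mono) auto
        finally show ?thesis .
      qed
      finally show "ennreal (a z) \<le> ennreal (L powr (1 - p)) * ?X z + ennreal (L * y)"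
        using L y by (simp add: ennreal_mult mult_left_mono)
    qed
    also have "y powr (p - 1) = K powr (p - 1) * ?r powr (-d)"
      using K bd by (simp add: y_def powr_mult powr_powr)
    finally show ?thesis
      by (simp add: ennreal_mult mult_ac)
  qed
  have "(\<integral>\<^sup>+z\<in>D. ennreal (a z powr p) \<partial>lborel) \<le>
      (\<integral>\<^sup>+z. ennreal (2 powr p * K powr (p - 1)) * (ennreal (cmod (z - c) powr (-d)) * ?X z) \<partial>lborel)"
  proof (rule nn_integral_mono_AE, use AE_lborel_neq[of c] in eventually_elim)
    case (elim z)
    then show ?case using pt[of z] by (cases "z \<in> D") simp_all
  qed
  also have "\<dots> = ennreal (2 powr p * K powr (p - 1)) *
      (\<integral>\<^sup>+z. \<integral>\<^sup>+w. ennreal (cmod (z - c) powr (-d)) * ennreal (h w powr p * cmod (w - c) powr d * ?k z w) \<partial>lborel \<partial>lborel)"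
    by (simp add: nn_integral_cmult)
  also have "(\<integral>\<^sup>+z. \<integral>\<^sup>+w. ennreal (cmod (z - c) powr (-d)) * ennreal (h w powr p * cmod (w - c) powr d * ?k z w) \<partial>lborel \<partial>lborel)
     = (\<integral>\<^sup>+w. \<integral>\<^sup>+z. ennreal (h w powr p * cmod (w - c) powr d) * ennreal (cmod (z - c) powr (-d) / (cmod (z - c) + cmod (w - c))\<^sup>2) \<partial>lborel \<partial>lborel)"
    by (subst lborel_pair.Fubini') (auto intro!: nn_integral_cong simp: ennreal_mult[symmetric] mult_ac)
  also have "\<dots> \<le> (\<integral>\<^sup>+w. ennreal K' * ennreal (h w powr p) \<partial>lborel)"
  proof (rule nn_integral_mono_AE, use AE_lborel_neq[of c] in eventually_elim)
    case (elim w)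
    then have r: "0 < cmod (w - c)" by simp
    have "(\<integral>\<^sup>+z. ennreal (h w powr p * cmod (w - c) powr d) * ennreal (cmod (z - c) powr (-d) / (cmod (z - c) + cmod (w - c))\<^sup>2) \<partial>lborel)
      \<le> ennreal (h w powr p * cmod (w - c) powr d) * ennreal (K' * cmod (w - c) powr (-d))"
      unfolding K'_def using nn_integral_powr_kernel_complex[OF bd(3,4) r, of c]
      by (subst nn_integral_cmult) (auto intro: mult_left_mono)
    also have "\<dots> = ennreal K' * ennreal (h w powr p)"
      using K r by (simp add: ennreal_mult[symmetric] powr_minus)
    finally show "(\<integral>\<^sup>+z. ennreal (h w powr p * cmod (w - c) powr d) * ennreal (cmod (z - c) powr (-d) / (cmod (z - c) + cmod (w - c))\<^sup>2) \<partial>lborel)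
      \<le> ennreal K' * ennreal (h w powr p)" .
  qed
  also have "\<dots> = ennreal K' * (\<integral>\<^sup>+w. ennreal (h w powr p) \<partial>lborel)"
    by (simp add: nn_integral_cmult)
  finally show ?thesis
    using K by (simp add: const ennreal_mult mult_left_mono mult.assoc)
qed

subsection \<open>Splitting the Cauchy integral\<close>

definition closed_unit_square :: "complex set" where
  "closed_unit_square = cbox 0 (1 + \<i>)"

lemma closed_unit_square_iff:
  "z \<in> closed_unit_square \<longleftrightarrow> 0 \<le> Re z \<and> Re z \<le> 1 \<and> 0 \<le> Im z \<and> Im z \<le> 1"
  by (auto simp: closed_unit_square_def in_cbox_complex_iff)

lemma convex_closed_unit_square: "convex closed_unit_square"
  by (simp add: closed_unit_square_def)

text \<open>The factor equals 1 on the diagonal, so it does not affect Cauchy's formula. Its poles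
  \<open>2 - z\<close> and \<open>2 * \<i> - z\<close> in \<open>w\<close> are the reflections of \<open>z\<close> in the corners and stay off the closed
  square for \<open>z\<close> in either quadrant, while its zeros at the corners give the kernel the extra decay
  that makes it bounded on \<open>L\<^sup>p\<close> for every \<open>p > 1\<close>.\<close>

definition corner_factor :: "complex \<Rightarrow> complex \<Rightarrow> complex" where
  "corner_factor z w = 4 * (w - 1) * (w - \<i>) / ((z + w - 2) * (z + w - 2 * \<i>))"

definition mod_cauchy :: "(complex \<Rightarrow> complex) \<Rightarrow> complex \<Rightarrow> complex \<Rightarrow> complex" where
  "mod_cauchy f z w = f w * corner_factor z w / (w - z)"

text \<open>The point \<open>2 - w\<close> has real part at least 1 and imaginary part at most 0, so
  it lies in neither quadrant; \<open>2 * \<i> - w\<close> is excluded with the coordinates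
  exchanged.\<close>

lemma quadrants_denominators_nonzero:
  assumes "z \<in> open_quadrant \<union> opposite_quadrant" "w \<in> closed_unit_square"
  shows "z + w - 2 \<noteq> 0" "z + w - 2 * \<i> \<noteq> 0"
  using assms by (auto simp: open_quadrant_def opposite_quadrant_iff closed_unit_square_iff complex_eq_iff)

lemma corner_factor_holomorphic:
  assumes "z \<in> open_quadrant \<union> opposite_quadrant" "S \<subseteq> closed_unit_square"
  shows "corner_factor z holomorphic_on S"
  unfolding corner_factor_def using assms quadrants_denominators_nonzero[OF assms(1)]
  by (intro holomorphic_intros) auto

lemma mod_cauchy_holomorphic:
  assumes "f holomorphic_on closed_unit_square" "z \<in> open_quadrant \<union> opposite_quadrant"
    "S \<subseteq> closed_unit_square" "z \<notin> S"
  shows "mod_cauchy f z holomorphic_on S"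
  unfolding mod_cauchy_def using assms
  by (intro holomorphic_intros corner_factor_holomorphic holomorphic_on_subset[OF assms(1)]) auto

lemma mod_cauchy_contour_integrable:
  assumes "f holomorphic_on closed_unit_square" "z \<in> open_quadrant \<union> opposite_quadrant"
    "closed_segment a b \<subseteq> closed_unit_square" "z \<notin> closed_segment a b"
  shows "mod_cauchy f z contour_integrable_on linepath a b"
  using mod_cauchy_holomorphic[OF assms]
  by (intro contour_integrable_continuous_linepath holomorphic_on_imp_continuous_on)

lemma closed_segment_subset_square:
  "a \<in> closed_unit_square \<Longrightarrow> b \<in> closed_unit_square \<Longrightarrow> closed_segment a b \<subseteq> closed_unit_square"
  using convex_closed_unit_square by (simp add: convex_contains_segment)

text \<open>Differentiation under the integral sign: for fixed \<open>w\<close> the kernel is a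
  constant over a polynomial in \<open>z\<close>, which has no zero as long as \<open>z\<close>
  stays off the segment.\<close>

lemma contour_integral_mod_cauchy_holomorphic:
  assumes f: "f holomorphic_on closed_unit_square"
    and ab: "a \<in> closed_unit_square" "b \<in> closed_unit_square"
    and U: "convex U" "U \<subseteq> open_quadrant \<union> opposite_quadrant" "U \<inter> closed_segment a b = {}"
  shows "(\<lambda>z. contour_integral (linepath a b) (mod_cauchy f z)) holomorphic_on U"
proof -
  \<comment> \<open>\<open>D\<close> collects all factors depending on \<open>z\<close>,
    \<open>D'\<close> is its derivative in \<open>z\<close>, and \<open>N\<close> includes the speed
    \<open>b - a\<close> of the path.\<close>
  define D where "D = (\<lambda>z w. (z + w - 2) * (z + w - 2 * \<i>) * (w - z))"
  define D' where "D' = (\<lambda>z w. (z + w - 2 * \<i>) * (w - z) + (z + w - 2) * (w - z) - (z + w - 2) * (z + w - 2 * \<i>))"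
  define N where "N = (\<lambda>w. f w * (4 * (w - 1) * (w - \<i>)) * (b - a))"
  have seg: "linepath a b t \<in> closed_unit_square" "linepath a b t \<in> closed_segment a b" if "t \<in> {0..1}" for t
    using closed_segment_subset_square[OF ab] that path_image_linepath[of a b]
    by (auto simp: path_image_def)
  have D: "D z (linepath a b t) \<noteq> 0" if "z \<in> U" "t \<in> {0..1}" for z t
    using quadrants_denominators_nonzero[of z "linepath a b t"] seg[OF that(2)] that U
    by (auto simp: D_def)
  have N: "continuous_on {0..1} (\<lambda>t. N (linepath a b t))"
    unfolding N_def using seg
    by (intro continuous_intros continuous_on_compose2[OF holomorphic_on_imp_continuous_on[OF f]]) auto
  have "(\<lambda>z. integral (cbox 0 1) (\<lambda>t. N (linepath a b t) / D z (linepath a b t))) holomorphic_on U"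
  proof (rule leibniz_rule_holomorphic[where fx = "\<lambda>z t. - (N (linepath a b t) * D' z (linepath a b t)) / (D z (linepath a b t))\<^sup>2"])
    fix z and t :: real assume zt: "z \<in> U" "t \<in> cbox 0 1"
    have "((\<lambda>z. D z w) has_field_derivative D' z w) (at z within U)" for w
      unfolding D_def D'_def by (auto intro!: derivative_eq_intros simp: algebra_simps)
    then show "((\<lambda>z. N (linepath a b t) / D z (linepath a b t)) has_field_derivative
        - (N (linepath a b t) * D' z (linepath a b t)) / (D z (linepath a b t))\<^sup>2) (at z within U)"
      using D zt by (auto intro!: derivative_eq_intros simp: power2_eq_square)
  next
    fix z assume z: "z \<in> U"
    have "continuous_on {0..1} (\<lambda>t. N (linepath a b t) / D z (linepath a b t))"
      using D[OF z] by (intro continuous_on_divide N) (auto simp: D_def intro!: continuous_intros)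
    then show "(\<lambda>t. N (linepath a b t) / D z (linepath a b t)) integrable_on cbox 0 1"
      by (simp add: integrable_continuous_real)
  next
    have "continuous_on (U \<times> {0..1}) (\<lambda>q. - (N (linepath a b (snd q)) * D' (fst q) (linepath a b (snd q))) /
        (D (fst q) (linepath a b (snd q)))\<^sup>2)"
      using D by (intro continuous_on_divide continuous_on_minus continuous_on_mult
          continuous_on_compose2[OF N] continuous_intros)
        (auto simp: D_def D'_def linepath_def intro!: continuous_intros)
    then show "continuous_on (U \<times> cbox 0 1) (\<lambda>(z, t). - (N (linepath a b t) * D' z (linepath a b t)) /
        (D z (linepath a b t))\<^sup>2)"
      by (simp add: case_prod_unfold)
  qed (use U in auto)
  moreover have "contour_integral (linepath a b) (mod_cauchy f z) =
      integral (cbox 0 1) (\<lambda>t. N (linepath a b t) / D z (linepath a b t))" for z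
    unfolding contour_integral_integral cbox_interval
    by (intro integral_cong) (simp add: mod_cauchy_def corner_factor_def N_def D_def)
  ultimately show ?thesis by simp
qed

lemma contour_integral_triangle:
  assumes "f holomorphic_on convex hull {a, b, c}"
  shows "contour_integral (linepath a b) f + contour_integral (linepath b c) f = contour_integral (linepath a c) f"
proof -
  have cont: "continuous_on (closed_segment x y) f" if "x \<in> {a, b, c}" "y \<in> {a, b, c}" for x y
  proof (rule continuous_on_subset[OF holomorphic_on_imp_continuous_on[OF assms]])
    show "closed_segment x y \<subseteq> convex hull {a, b, c}"
      using that by (intro closed_segment_subset convex_convex_hull hull_inc)
  qed
  have int: "f contour_integrable_on linepath x y" if "x \<in> {a, b, c}" "y \<in> {a, b, c}" for x y
    using cont[OF that] by (rule contour_integrable_continuous_linepath)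
  have "contour_integral (linepath a b +++ linepath b c +++ linepath c a) f = 0"
    by (rule contour_integral_unique[OF Cauchy_theorem_triangle[OF assms]])
  then have "contour_integral (linepath a b) f + (contour_integral (linepath b c) f + contour_integral (linepath c a) f) = 0"
    using int by (subst (asm) contour_integral_join, simp_all)
  moreover have "contour_integral (linepath c a) f = - contour_integral (linepath a c) f"
    using cont by (intro contour_integral_reverse_linepath) auto
  ultimately show ?thesis by (simp add: algebra_simps)
qed

section \<open>The two parts of the Cauchy integral\<close>

definition lower_part :: "(complex \<Rightarrow> complex) \<Rightarrow> complex \<Rightarrow> complex" where
  "lower_part f z = (contour_integral (linepath \<i> 0) (mod_cauchy f z) +
     contour_integral (linepath 0 1) (mod_cauchy f z)) / (2 * of_real pi * \<i>)"

definition upper_part :: "(complex \<Rightarrow> complex) \<Rightarrow> complex \<Rightarrow> complex" where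
  "upper_part f z = (contour_integral (linepath 1 (1 + \<i>)) (mod_cauchy f z) +
     contour_integral (linepath (1 + \<i>) \<i>) (mod_cauchy f z)) / (2 * of_real pi * \<i>)"

text \<open>The point where the two segments of the curve \<open>kinked_curve t\<close> meet on the diagonal; they leave
  the corners \<open>1\<close> and \<open>\<i>\<close> with slopes \<open>- t\<close> and \<open>- 1 / t\<close>.\<close>

definition kink :: "real \<Rightarrow> complex" where
  "kink t = of_real (t / (1 + t)) * (1 + \<i>)"

text \<open>Integral along the path from \<open>1\<close> over \<open>kink t\<close> to
  \<open>\<i>\<close>. Both segments are written as starting at their corner, hence the minus sign,
  because the estimates are parametrised by the distance to the corner.\<close>

definition kinked_integral :: "(complex \<Rightarrow> complex) \<Rightarrow> real \<Rightarrow> complex \<Rightarrow> complex" where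
  "kinked_integral f t z = (contour_integral (linepath 1 (kink t)) (mod_cauchy f z) -
     contour_integral (linepath \<i> (kink t)) (mod_cauchy f z)) / (2 * of_real pi * \<i>)"

lemma square_corners [simp]:
  "0 \<in> closed_unit_square" "1 \<in> closed_unit_square" "\<i> \<in> closed_unit_square" "1 + \<i> \<in> closed_unit_square"
  by (simp_all add: closed_unit_square_iff)

lemma kink_in_square [simp]: "1 \<le> t \<Longrightarrow> kink t \<in> closed_unit_square"
  by (simp add: kink_def closed_unit_square_iff)

lemma Re_Im_kink: "Re (kink t) = t / (1 + t)" "Im (kink t) = t / (1 + t)"
  by (simp_all add: kink_def)

lemma kink_on_line:
  fixes t :: real
  assumes "1 \<le> t"
  shows "t * (1 - t / (1 + t)) = t / (1 + t)"
proof -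
  have "1 - t / (1 + t) = 1 / (1 + t)" using assms by (simp add: field_simps)
  then show ?thesis by simp
qed

text \<open>The two sides of this contour lie on the boundary of the quadrant, so no point of the
  quadrant, inside the square or beyond it, meets them. This is what extends the part past the
  square.\<close>

lemma lower_part_holomorphic:
  assumes "f holomorphic_on closed_unit_square"
  shows "lower_part f holomorphic_on open_quadrant"
proof -
  have conv: "convex open_quadrant"
    unfolding open_quadrant_def Collect_conj_eq
    by (intro convex_Int convex_halfspace_Re_gt convex_halfspace_Im_gt)
  have "closed_segment \<i> 0 \<subseteq> {z. Re z \<le> 0}" "closed_segment 0 1 \<subseteq> {z. Im z \<le> 0}"
    by (intro closed_segment_subset convex_halfspace_Re_le convex_halfspace_Im_le; simp)+
  then have "open_quadrant \<inter> closed_segment \<i> 0 = {}" "open_quadrant \<inter> closed_segment 0 1 = {}"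
    by (auto simp: open_quadrant_def)
  then show ?thesis
    unfolding lower_part_def using conv assms
    by (intro holomorphic_intros contour_integral_mod_cauchy_holomorphic) auto
qed

lemma upper_part_holomorphic:
  assumes "f holomorphic_on closed_unit_square"
  shows "upper_part f holomorphic_on opposite_quadrant"
proof -
  have eq: "opposite_quadrant = {z. Re z < 1} \<inter> {z. Im z < 1}"
    by (auto simp: opposite_quadrant_iff)
  have conv: "convex opposite_quadrant"
    unfolding eq by (intro convex_Int convex_halfspace_Re_lt convex_halfspace_Im_lt)
  have "closed_segment 1 (1 + \<i>) \<subseteq> {z. Re z \<ge> 1}" "closed_segment (1 + \<i>) \<i> \<subseteq> {z. Im z \<ge> 1}"
    by (intro closed_segment_subset convex_halfspace_Re_ge convex_halfspace_Im_ge; simp)+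
  then have "opposite_quadrant \<inter> closed_segment 1 (1 + \<i>) = {}" "opposite_quadrant \<inter> closed_segment (1 + \<i>) \<i> = {}"
    by (fastforce simp: opposite_quadrant_iff)+
  then show ?thesis
    unfolding upper_part_def using conv assms
    by (intro holomorphic_intros contour_integral_mod_cauchy_holomorphic) auto
qed

text \<open>Cauchy's formula for \<open>f w * corner_factor z w\<close> as a function of
  \<open>w\<close>, whose value at \<open>w = z\<close> is \<open>f z\<close>. The four sides are
  listed counterclockwise and regrouped.\<close>

lemma lower_plus_upper:
  assumes f: "f holomorphic_on closed_unit_square" and z: "z \<in> open_unit_square"
  shows "lower_part f z + upper_part f z = f z"
proof -
  have zQ: "z \<in> open_quadrant \<union> opposite_quadrant"
    using z by (simp add: open_unit_square_eq_Int)
  have zb: "z \<in> box 0 (1 + \<i>)"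
    using z by (simp add: open_unit_square_def in_box_complex_iff)
  have img: "path_image (rectpath 0 (1 + \<i>)) = cbox 0 (1 + \<i>) - box 0 (1 + \<i>)"
    by (rule path_image_rectpath_cbox_minus_box) simp_all
  have "((\<lambda>w. (f w * corner_factor z w) / (w - z)) has_contour_integral
      of_real (2 * pi) * \<i> * winding_number (rectpath 0 (1 + \<i>)) z * (f z * corner_factor z z)) (rectpath 0 (1 + \<i>))"
  proof (rule Cauchy_integral_formula_convex_simple[OF convex_closed_unit_square])
    show "(\<lambda>w. f w * corner_factor z w) holomorphic_on closed_unit_square"
      using zQ by (intro holomorphic_intros f corner_factor_holomorphic) auto
    show "z \<in> interior closed_unit_square"
      using zb by (simp add: closed_unit_square_def interior_cbox)
    show "path_image (rectpath 0 (1 + \<i>)) \<subseteq> closed_unit_square - {z}"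
      unfolding img using zb by (auto simp: closed_unit_square_def)
  qed simp_all
  moreover have "winding_number (rectpath 0 (1 + \<i>)) z = 1"
    using zb by (rule winding_number_rectpath)
  moreover have "corner_factor z z = 1"
  proof -
    have "z \<noteq> 1" "z \<noteq> \<i>" using z by (auto simp: open_unit_square_def)
    moreover have "(z + z - 2) * (z + z - 2 * \<i>) = 4 * (z - 1) * (z - \<i>)" by (simp add: algebra_simps)
    ultimately show ?thesis by (simp add: corner_factor_def)
  qed
  ultimately have ci: "contour_integral (rectpath 0 (1 + \<i>)) (mod_cauchy f z) = 2 * of_real pi * \<i> * f z"
    by (auto simp: mod_cauchy_def[abs_def] dest!: contour_integral_unique)
  have notin: "z \<notin> closed_segment 0 1" "z \<notin> closed_segment 1 (1 + \<i>)"
    "z \<notin> closed_segment (1 + \<i>) \<i>" "z \<notin> closed_segment \<i> 0"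
    using img zb path_image_rectpath[of 0 "1 + \<i>"]
    by (auto simp: closed_segment_same_Re closed_segment_same_Im in_box_complex_iff)
  have int: "mod_cauchy f z contour_integrable_on linepath a b"
    if "z \<notin> closed_segment a b" "a \<in> closed_unit_square" "b \<in> closed_unit_square" for a b
    using that by (intro mod_cauchy_contour_integrable f zQ closed_segment_subset_square)
  have rect: "rectpath 0 (1 + \<i>) = linepath 0 1 +++ linepath 1 (1 + \<i>) +++ linepath (1 + \<i>) \<i> +++ linepath \<i> 0"
  proof -
    have "Complex (Re (1 + \<i>)) (Im 0) = 1" "Complex (Re 0) (Im (1 + \<i>)) = \<i>"
      by (simp_all add: complex_eq_iff)
    then show ?thesis by (simp add: rectpath_def Let_def)
  qed
  have "contour_integral (rectpath 0 (1 + \<i>)) (mod_cauchy f z) =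
      contour_integral (linepath 0 1) (mod_cauchy f z) + (contour_integral (linepath 1 (1 + \<i>)) (mod_cauchy f z) +
      (contour_integral (linepath (1 + \<i>) \<i>) (mod_cauchy f z) + contour_integral (linepath \<i> 0) (mod_cauchy f z)))"
    unfolding rect using int notin by (subst contour_integral_join, simp_all)+
  with ci show ?thesis
    by (simp add: lower_part_def upper_part_def add_divide_distrib[symmetric] field_simps)
qed

section \<open>Deforming the contours onto a kinked curve\<close>

definition below_curve :: "real \<Rightarrow> complex set" where
  "below_curve t = {z. 0 \<le> Re z \<and> 0 \<le> Im z \<and> Im z \<le> t * (1 - Re z) \<and> Re z \<le> t * (1 - Im z)}"

text \<open>For \<open>1 \<le> t\<close> the kink lies on or beyond the chord from \<open>1\<close>
  to \<open>\<i>\<close>. Hence the region below is an intersection of half-planes, whereas this one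
  is a union of two convex pieces, one for each segment of the curve.\<close>

definition above_curve :: "real \<Rightarrow> complex set" where
  "above_curve t = {z. Re z \<le> 1 \<and> Im z \<le> 1 \<and> (t * (1 - Re z) \<le> Im z \<or> t * (1 - Im z) \<le> Re z)}"

lemma convex_affine_halfspace: "convex {z. a * Re z + b * Im z \<le> c}"
proof -
  have "{z. a * Re z + b * Im z \<le> c} = {z. inner (Complex a b) z \<le> c}"
    by (simp add: inner_complex_def)
  then show ?thesis by (simp add: convex_halfspace_le)
qed

lemma lower_part_eq_kinked_integral:
  assumes f: "f holomorphic_on closed_unit_square" and t: "1 \<le> t"
    and z: "z \<in> open_quadrant \<union> opposite_quadrant" "z \<notin> below_curve t"
  shows "lower_part f z = - kinked_integral f t z"
proof -
  let ?F = "mod_cauchy f z"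
  have eq: "below_curve t = {z. (-1) * Re z + 0 * Im z \<le> 0} \<inter> {z. 0 * Re z + (-1) * Im z \<le> 0} \<inter>
      {z. t * Re z + 1 * Im z \<le> t} \<inter> {z. 1 * Re z + t * Im z \<le> t}"
    by (auto simp: below_curve_def algebra_simps)
  have "convex (below_curve t)"
    unfolding eq by (intro convex_Int convex_affine_halfspace)
  moreover have "0 \<in> below_curve t" "1 \<in> below_curve t" "\<i> \<in> below_curve t" "kink t \<in> below_curve t"
    using t kink_on_line[OF t] by (simp_all add: below_curve_def Re_Im_kink)
  ultimately have "convex hull {\<i>, 0, kink t} \<subseteq> below_curve t" "convex hull {0, 1, kink t} \<subseteq> below_curve t"
    by (simp_all add: subset_hull)
  moreover have "convex hull {\<i>, 0, kink t} \<subseteq> closed_unit_square" "convex hull {0, 1, kink t} \<subseteq> closed_unit_square"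
    using convex_closed_unit_square t by (simp_all add: subset_hull)
  ultimately have hol: "?F holomorphic_on convex hull {\<i>, 0, kink t}" "?F holomorphic_on convex hull {0, 1, kink t}"
    using z by (auto intro!: mod_cauchy_holomorphic f)
  \<comment> \<open>The segment from \<open>0\<close> to \<open>kink t\<close> cuts the region into
    two triangles. Its integral enters with opposite signs and cancels.\<close>
  show ?thesis
    unfolding lower_part_def kinked_integral_def contour_integral_triangle[OF hol(1), symmetric]
      contour_integral_triangle[OF hol(2), symmetric]
    by (simp add: minus_divide_left)
qed

lemma upper_part_eq_kinked_integral:
  assumes f: "f holomorphic_on closed_unit_square" and t: "1 \<le> t"
    and z: "z \<in> open_quadrant \<union> opposite_quadrant" "z \<notin> above_curve t"
  shows "upper_part f z = kinked_integral f t z"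
proof -
  let ?F = "mod_cauchy f z"
  \<comment> \<open>\<open>above_curve t\<close> need not be convex, so each of the two triangles is
    placed in its own convex piece.\<close>
  let ?A1 = "{z. 1 * Re z + 0 * Im z \<le> 1} \<inter> {z. 0 * Re z + 1 * Im z \<le> 1} \<inter> {z. (- t) * Re z + (-1) * Im z \<le> - t}"
  let ?A2 = "{z. 1 * Re z + 0 * Im z \<le> 1} \<inter> {z. 0 * Re z + 1 * Im z \<le> 1} \<inter> {z. (-1) * Re z + (- t) * Im z \<le> - t}"
  have sub: "?A1 \<subseteq> above_curve t" "?A2 \<subseteq> above_curve t"
    by (auto simp: above_curve_def algebra_simps)
  have "convex ?A1" "convex ?A2"
    by (intro convex_Int convex_affine_halfspace)+
  moreover have "1 \<in> ?A1" "1 + \<i> \<in> ?A1" "kink t \<in> ?A1" "1 + \<i> \<in> ?A2" "\<i> \<in> ?A2" "kink t \<in> ?A2"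
    using t kink_on_line[OF t] by (simp_all add: Re_Im_kink algebra_simps)
  ultimately have "convex hull {1, 1 + \<i>, kink t} \<subseteq> ?A1" "convex hull {1 + \<i>, \<i>, kink t} \<subseteq> ?A2"
    by (intro hull_minimal; blast)+
  moreover have "convex hull {1, 1 + \<i>, kink t} \<subseteq> closed_unit_square" "convex hull {1 + \<i>, \<i>, kink t} \<subseteq> closed_unit_square"
    using convex_closed_unit_square t by (simp_all add: subset_hull)
  ultimately have hol: "?F holomorphic_on convex hull {1, 1 + \<i>, kink t}" "?F holomorphic_on convex hull {1 + \<i>, \<i>, kink t}"
    using z sub by (auto intro!: mod_cauchy_holomorphic f)
  show ?thesis
    unfolding upper_part_def kinked_integral_def contour_integral_triangle[OF hol(1), symmetric]
      contour_integral_triangle[OF hol(2), symmetric]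
    by (simp add: minus_divide_left)
qed

text \<open>The parameter \<open>s\<close> is the distance to the corner in one coordinate. Both
  arcs end at \<open>kink t\<close>, since \<open>t * s = 1 - s\<close> for
  \<open>s = 1 / (1 + t)\<close>.\<close>

definition kinked_curve :: "real \<Rightarrow> complex set" where
  "kinked_curve t = {Complex (1 - s) (t * s) | s. 0 \<le> s \<and> s \<le> 1 / (1 + t)} \<union>
     {Complex (t * s) (1 - s) | s. 0 \<le> s \<and> s \<le> 1 / (1 + t)}"

text \<open>A point off the curve therefore lies outside at least one of the two regions, and there
  the corresponding contour can be deformed.\<close>

lemma below_Int_above_curve:
  assumes "1 < t"
  shows "below_curve t \<inter> above_curve t \<subseteq> kinked_curve t"
proof
  fix z assume "z \<in> below_curve t \<inter> above_curve t"
  then have z: "Im z \<le> t * (1 - Re z)" "Re z \<le> t * (1 - Im z)" "Re z \<le> 1" "Im z \<le> 1"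
     "t * (1 - Re z) \<le> Im z \<or> t * (1 - Im z) \<le> Re z"
    by (auto simp: below_curve_def above_curve_def)
  \<comment> \<open>Eliminating \<open>y\<close> gives
    \<open>(1 - x) * (t * t - 1) \<le> t - 1\<close>; strictness of \<open>1 < t\<close> allows the
    factor \<open>t - 1\<close> to be cancelled.\<close>
  have aux: "0 \<le> 1 - x \<and> 1 - x \<le> 1 / (1 + t)" if "x \<le> t * (1 - y)" "y = t * (1 - x)" "x \<le> 1" for x y
  proof -
    have "(1 - x) * (t * t - 1) \<le> t - 1" using that by (simp add: algebra_simps)
    also have "t * t - 1 = (1 + t) * (t - 1)" by (simp add: algebra_simps)
    finally have "(t - 1) * ((1 - x) * (1 + t)) \<le> (t - 1) * 1" by (simp add: mult_ac)
    then have "(1 - x) * (1 + t) \<le> 1" using assms by (simp only: mult_le_cancel_left_pos)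
    then show ?thesis using that assms by (simp add: field_simps)
  qed
  from z(5) show "z \<in> kinked_curve t"
  proof
    assume "t * (1 - Re z) \<le> Im z"
    then have eq: "Im z = t * (1 - Re z)" using z by simp
    have "z = Complex (1 - (1 - Re z)) (t * (1 - Re z))" using eq by (simp add: complex_eq_iff)
    then show ?thesis using aux[OF z(2) eq z(3)] unfolding kinked_curve_def by blast
  next
    assume "t * (1 - Im z) \<le> Re z"
    then have eq: "Re z = t * (1 - Im z)" using z by simp
    have "z = Complex (t * (1 - Im z)) (1 - (1 - Im z))" using eq by (simp add: complex_eq_iff)
    then show ?thesis using aux[OF z(1) eq z(4)] unfolding kinked_curve_def by blast
  qed
qed

text \<open>For \<open>z\<close> between the lower sides and the curve it is the upper part, not the lower one, whose
  contour can be deformed to the curve without crossing \<open>z\<close>; this costs the term \<open>f z\<close>.\<close>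

lemma norm_lower_part_le:
  assumes f: "f holomorphic_on closed_unit_square" and t: "1 < t" "t \<le> 3"
    and z: "z \<in> open_quadrant" "z \<notin> kinked_curve t"
  shows "cmod (lower_part f z) \<le> (if z \<in> below_curve 3 then cmod (f z) else 0) + cmod (kinked_integral f t z)"
proof (cases "z \<in> below_curve t")
  case True
  have sq: "z \<in> open_unit_square"
  proof -
    have "Re z \<noteq> 1" "Im z \<noteq> 1" using True z by (auto simp: below_curve_def open_quadrant_def)
    moreover have "0 \<le> t * (1 - Re z)" "0 \<le> t * (1 - Im z)" using True by (auto simp: below_curve_def)
    ultimately show ?thesis using z t by (auto simp: open_unit_square_def open_quadrant_def zero_le_mult_iff)
  qed
  have "z \<notin> above_curve t" using below_Int_above_curve[of t] t True z by auto
  then have "upper_part f z = kinked_integral f t z"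
    using t z by (intro upper_part_eq_kinked_integral f) auto
  then have "lower_part f z = f z - kinked_integral f t z"
    using lower_plus_upper[OF f sq] by (simp add: algebra_simps)
  \<comment> \<open>Within the square the regions grow with \<open>t\<close>. Passing to the largest
    one makes the term with \<open>f z\<close> independent of the slope, as the averaging
    requires.\<close>
  moreover have "z \<in> below_curve 3"
  proof -
    have "t * (1 - Re z) \<le> 3 * (1 - Re z)" "t * (1 - Im z) \<le> 3 * (1 - Im z)"
      using sq t mult_right_mono[of t 3 "1 - Re z"] mult_right_mono[of t 3 "1 - Im z"]
      by (simp_all only: open_unit_square_def mem_Collect_eq diff_ge_0_iff_ge less_imp_le)
    then show ?thesis using True by (simp add: below_curve_def)
  qed
  ultimately show ?thesis by (simp add: norm_triangle_ineq4)
next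
  case False
  then show ?thesis using lower_part_eq_kinked_integral[OF f, of t z] t z by simp
qed

text \<open>The roles are exchanged: beyond the curve it is the lower contour that can be deformed
  without crossing \<open>z\<close>. These regions shrink as \<open>t\<close> grows, so
  \<open>above_curve 1\<close> contains them all.\<close>

lemma norm_upper_part_le:
  assumes f: "f holomorphic_on closed_unit_square" and t: "1 < t" "t \<le> 3"
    and z: "z \<in> opposite_quadrant" "z \<notin> kinked_curve t"
  shows "cmod (upper_part f z) \<le> (if z \<in> above_curve 1 then cmod (f z) else 0) + cmod (kinked_integral f t z)"
proof (cases "z \<in> above_curve t")
  case True
  have lt: "Re z < 1" "Im z < 1" using z by (auto simp: opposite_quadrant_iff)
  have le: "1 - Re z < t * (1 - Re z)" "1 - Im z < t * (1 - Im z)"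
    using lt t mult_strict_right_mono[of 1 t "1 - Re z"] mult_strict_right_mono[of 1 t "1 - Im z"]
    by (simp_all only: diff_gt_0_iff_gt mult_1)
  have alt: "t * (1 - Re z) \<le> Im z \<or> t * (1 - Im z) \<le> Re z"
    using True by (simp add: above_curve_def)
  have sq: "z \<in> open_unit_square"
    using alt lt le unfolding open_unit_square_def mem_Collect_eq by argo
  have "z \<notin> below_curve t" using below_Int_above_curve[of t] t True z by auto
  then have "lower_part f z = - kinked_integral f t z"
    using t z by (intro lower_part_eq_kinked_integral f) auto
  then have "upper_part f z = f z + kinked_integral f t z"
    using lower_plus_upper[OF f sq] by (simp add: algebra_simps)
  moreover have "z \<in> above_curve 1"
    using alt le lt unfolding above_curve_def mem_Collect_eq by argo
  ultimately show ?thesis by (simp add: norm_triangle_ineq)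
next
  case False
  then show ?thesis using upper_part_eq_kinked_integral[OF f, of t z] t z by simp
qed

subsection \<open>Averaging over curves\<close>

text \<open>Averaging over the slope turns integrals along segments through a corner into area integrals:
  for fixed \<open>s\<close> the substitution \<open>y = t * s\<close> is one-dimensional.\<close>

lemma nn_integral_cone_le:
  assumes [measurable]: "H \<in> borel_measurable borel"
  shows "(\<integral>\<^sup>+t. \<integral>\<^sup>+s. ennreal s * H (Complex (1 - s) (t * s)) * indicator {0<..} s \<partial>lborel \<partial>lborel) \<le> (\<integral>\<^sup>+w. H w \<partial>lborel)"
proof -
  have "(\<integral>\<^sup>+t. \<integral>\<^sup>+s. ennreal s * H (Complex (1 - s) (t * s)) * indicator {0<..} s \<partial>lborel \<partial>lborel) =
      (\<integral>\<^sup>+s. \<integral>\<^sup>+t. ennreal s * H (Complex (1 - s) (t * s)) * indicator {0<..} s \<partial>lborel \<partial>lborel)"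
    by (rule lborel_pair.Fubini') simp
  also have "\<dots> \<le> (\<integral>\<^sup>+s. \<integral>\<^sup>+y. H (Complex (1 - s) y) \<partial>lborel \<partial>lborel)"
  proof (rule nn_integral_mono)
    fix s :: real
    show "(\<integral>\<^sup>+t. ennreal s * H (Complex (1 - s) (t * s)) * indicator {0<..} s \<partial>lborel) \<le> (\<integral>\<^sup>+y. H (Complex (1 - s) y) \<partial>lborel)"
    proof (cases "0 < s")
      case True
      have "(\<integral>\<^sup>+y. H (Complex (1 - s) y) \<partial>lborel) = ennreal \<bar>s\<bar> * (\<integral>\<^sup>+t. H (Complex (1 - s) (0 + s * t)) \<partial>lborel)"
        using True by (intro nn_integral_real_affine) auto
      then show ?thesis using True by (simp add: nn_integral_cmult mult.commute)
    qed simp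
  qed
  also have "\<dots> = (\<integral>\<^sup>+x. \<integral>\<^sup>+y. H (Complex x y) \<partial>lborel \<partial>lborel)"
    using nn_integral_real_affine[where f = "\<lambda>x. \<integral>\<^sup>+y. H (Complex x y) \<partial>lborel" and c = "-1" and t = 1] by simp
  also have "\<dots> = (\<integral>\<^sup>+w. H w \<partial>lborel)"
    by (simp add: nn_integral_lborel_complex)
  finally show ?thesis .
qed

lemma nn_integral_cone_le':
  assumes [measurable]: "H \<in> borel_measurable borel"
  shows "(\<integral>\<^sup>+t. \<integral>\<^sup>+s. ennreal s * H (Complex (t * s) (1 - s)) * indicator {0<..} s \<partial>lborel \<partial>lborel) \<le> (\<integral>\<^sup>+w. H w \<partial>lborel)"
proof -
  have "(\<integral>\<^sup>+w. H (Complex (Im w) (Re w)) \<partial>lborel) = (\<integral>\<^sup>+w. H w \<partial>lborel)"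
    by (simp add: nn_integral_lborel_complex lborel_pair.Fubini'[of "\<lambda>x y. H (Complex x y)"])
  then show ?thesis
    using nn_integral_cone_le[of "\<lambda>w. H (Complex (Im w) (Re w))"] by simp
qed

lemma borel_measurable_ennreal_indicator:
  fixes g :: "'a :: topological_space \<Rightarrow> real"
  assumes "continuous_on W g" "W \<in> sets borel"
  shows "(\<lambda>x. ennreal (g x) * indicator W x) \<in> borel_measurable borel"
proof -
  have "(\<lambda>x. indicator W x *\<^sub>R g x) \<in> borel_measurable borel"
    using assms by (intro borel_measurable_continuous_on_indicator)
  then have "(\<lambda>x. ennreal (indicator W x *\<^sub>R g x)) \<in> borel_measurable borel"
    by (rule measurable_compose_rev[rotated]) simp
  moreover have "ennreal (indicator W x *\<^sub>R g x) = ennreal (g x) * indicator W x" for x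
    by (simp add: indicator_def)
  ultimately show ?thesis by (simp only:)
qed

text \<open>Substituting \<open>x = c * s\<close> in the path integral. With
  \<open>c = 1 + t\<close> the path becomes \<open>a + s *\<^sub>R v\<close>, in the parameter
  \<open>s\<close> of \<open>kinked_curve\<close> and of the averaging over cones.\<close>

lemma norm_contour_integral_linepath_le:
  fixes a v :: complex
  assumes F: "continuous_on (closed_segment a (a + v /\<^sub>R c)) F" and c: "0 < c"
  shows "ennreal (cmod (contour_integral (linepath a (a + v /\<^sub>R c)) F)) \<le>
    (\<integral>\<^sup>+s. ennreal (cmod v * cmod (F (a + s *\<^sub>R v))) * indicator {0..1 / c} s \<partial>lborel)"
proof -
  let ?b = "a + v /\<^sub>R c"
  let ?g = "\<lambda>x. F (linepath a ?b x) * (?b - a)"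
  have lin: "linepath a ?b x = a + (x / c) *\<^sub>R v" for x
    by (simp add: linepath_def algebra_simps divide_inverse)
  have seg: "linepath a ?b x \<in> closed_segment a ?b" if "x \<in> {0..1}" for x
    using that path_image_linepath[of a ?b] by (auto simp: path_image_def)
  have cont: "continuous_on {0..1} ?g"
    by (intro continuous_intros continuous_on_compose2[OF F]) (use seg in auto)
  then have cont_norm: "continuous_on {0..1} (\<lambda>x. cmod (?g x))"
    by (rule continuous_on_norm)
  have meas: "(\<lambda>x. ennreal (cmod (?g x)) * indicator {0..1} x) \<in> borel_measurable borel"
    by (rule borel_measurable_ennreal_indicator[OF cont_norm]) simp
  have "contour_integral (linepath a ?b) F = integral {0..1} ?g"
    by (simp add: contour_integral_integral)
  then have "cmod (contour_integral (linepath a ?b) F) \<le> integral {0..1} (\<lambda>x. cmod (?g x))"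
    by (simp only:) (intro integral_norm_bound_integral integrable_continuous_real cont cont_norm order_refl)
  then have "ennreal (cmod (contour_integral (linepath a ?b) F)) \<le> ennreal (integral {0..1} (\<lambda>x. cmod (?g x)))"
    by (rule ennreal_leI)
  also have "\<dots> = (\<integral>\<^sup>+x. ennreal (cmod (?g x)) * indicator {0..1} x \<partial>lborel)"
    using cont_norm
    by (intro nn_integral_has_integral_lebesgue'[symmetric] integrable_integral integrable_continuous_real) auto
  also have "\<dots> = ennreal \<bar>c\<bar> * (\<integral>\<^sup>+s. ennreal (cmod (?g (0 + c * s))) * indicator {0..1} (0 + c * s) \<partial>lborel)"
    by (rule nn_integral_real_affine[OF meas]) (use c in auto)
  also have "\<dots> = (\<integral>\<^sup>+s. ennreal (cmod v * cmod (F (a + s *\<^sub>R v))) * indicator {0..1 / c} s \<partial>lborel)"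
  proof (subst nn_integral_cmult[symmetric])
    show "(\<lambda>s. ennreal (cmod (?g (0 + c * s))) * indicator {0..1} (0 + c * s)) \<in> borel_measurable lborel"
      unfolding measurable_lborel1 by (rule measurable_compose[OF _ meas]) simp
    show "(\<integral>\<^sup>+s. ennreal \<bar>c\<bar> * (ennreal (cmod (?g (0 + c * s))) * indicator {0..1} (0 + c * s)) \<partial>lborel) =
        (\<integral>\<^sup>+s. ennreal (cmod v * cmod (F (a + s *\<^sub>R v))) * indicator {0..1 / c} s \<partial>lborel)"
    proof (rule nn_integral_cong)
      fix s :: real
      have "ennreal \<bar>c\<bar> * ennreal (cmod (?g (0 + c * s))) = ennreal (cmod v * cmod (F (a + s *\<^sub>R v)))"
        using c unfolding lin by (subst ennreal_mult[symmetric]) (auto simp: norm_mult)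
      moreover have "indicator {0..1} (0 + c * s) = (indicator {0..1 / c} s :: ennreal)"
        using c by (auto simp: indicator_def field_simps zero_le_mult_iff)
      ultimately show "ennreal \<bar>c\<bar> * (ennreal (cmod (?g (0 + c * s))) * indicator {0..1} (0 + c * s)) =
          ennreal (cmod v * cmod (F (a + s *\<^sub>R v))) * indicator {0..1 / c} s"
        by (simp add: mult.assoc[symmetric])
    qed
  qed
  finally show ?thesis .
qed

text \<open>Here \<open>46368 = 32 * 9 * 161\<close>. The later constants arise from it by factors 4, for
  \<open>cmod (w - c) \<le> 4 * s\<close>, for the speed of the curve and for the length \<open>1 / 4\<close> of the range of slopes.\<close>

lemma homogeneous_kernel_bound:
  fixes A B D P R S :: real
  assumes "0 < R" "0 \<le> P" "0 \<le> B" "B \<le> 2" "1 / 4 \<le> D" "R \<le> 4 * A" "R \<le> 80 * S" "P \<le> A + R" "P \<le> S + R"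
  shows "4 * R * B / (A * D) / S \<le> 46368 * (R / (P + R)\<^sup>2)"
proof -
  have pos: "0 < A" "0 < S" using assms by linarith+
  \<comment> \<open>\<open>P + R \<le> A + 2 * R \<le> 9 * A\<close> and
    \<open>P + R \<le> S + 2 * R \<le> 161 * S\<close>.\<close>
  have "(P + R) * (P + R) \<le> (9 * A) * (161 * S)"
    using assms pos by (intro mult_mono) linarith+
  then have sq: "(P + R)\<^sup>2 \<le> 1449 * (A * S)" by (simp add: power2_eq_square)
  have "4 * R * B / (A * D) / S = (4 * R / (A * S)) * (B / D)"
    by (simp add: field_simps)
  also have "B / D \<le> 2 / (1 / 4)"
    using assms by (intro frac_le) auto
  then have "(4 * R / (A * S)) * (B / D) \<le> (4 * R / (A * S)) * 8"
    using assms pos by (intro mult_left_mono) auto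
  also have "\<dots> = 46368 * (R / (1449 * (A * S)))"
    by simp
  also have "\<dots> \<le> 46368 * (R / (P + R)\<^sup>2)"
    using assms pos sq by (intro mult_left_mono divide_left_mono) auto
  finally show ?thesis .
qed

lemma cmod_le_abs_add: "cmod (Complex x y) \<le> \<bar>x\<bar> + \<bar>y\<bar>"
  using cmod_le[of "Complex x y"] by simp

text \<open>Near the corner \<open>1\<close>, both \<open>z + w - 2\<close> and \<open>w - z\<close>
  have modulus at least a multiple of \<open>cmod (w - 1)\<close>, hence by the triangle inequality
  also of \<open>cmod (z - 1) + cmod (w - 1)\<close>. The factors belonging to the other corner stay
  between positive constants where needed.\<close>

lemma cmod_mod_cauchy_le_near_one:
  assumes z: "z \<in> open_quadrant \<union> opposite_quadrant"
    and t: "1 \<le> t" "t \<le> 3" and s: "0 < s" "s \<le> 1 / (1 + t)"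
    and far: "s \<le> 20 * cmod (z - Complex (1 - s) (t * s))"
  shows "cmod (mod_cauchy f z (Complex (1 - s) (t * s))) \<le>
    185472 * s * (cmod (f (Complex (1 - s) (t * s))) /
      (cmod (z - 1) + cmod (Complex (1 - s) (t * s) - 1))\<^sup>2)"
proof -
  let ?w = "Complex (1 - s) (t * s)"
  let ?R = "cmod (?w - 1)" and ?P = "cmod (z - 1)"
  define u where "u = t * s"
  have u: "s \<le> u" "u \<le> 3 * s" using t s by (simp_all add: u_def)
  have sum: "s + u \<le> 1" using s t by (simp add: u_def field_simps)
  have zc: "0 < Re z \<and> 0 < Im z \<or> Re z < 1 \<and> Im z < 1"
    using z by (auto simp: open_quadrant_def opposite_quadrant_iff)
  have w1: "?w - 1 = Complex (- s) u" and wi: "?w - \<i> = Complex (1 - s) (u - 1)"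
    by (simp_all add: complex_eq_iff u_def)
  have ReIm: "Re (z + ?w - 2) = Re z - 1 - s" "Im (z + ?w - 2) = Im z + u"
    "Re (z + ?w - 2 * \<i>) = Re z + 1 - s" "Im (z + ?w - 2 * \<i>) = Im z + u - 2"
    by (simp_all add: u_def)
  have R: "0 < ?R" using s by (simp add: w1 complex_eq_iff)
  have "?R \<le> s + u"
    using cmod_le_abs_add[of "-s" u] s u unfolding w1 by simp
  then have R4: "?R \<le> 4 * s" "?R \<le> 4 * u"
    using u by linarith+
  have A: "?R \<le> 4 * cmod (z + ?w - 2)"
  proof -
    \<comment> \<open>In the first quadrant the imaginary part is large enough, in the opposite
      quadrant the real part is negative enough.\<close>
    have "s \<le> Im (z + ?w - 2) \<or> s \<le> - Re (z + ?w - 2)"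
      using zc s u unfolding ReIm by argo
    then have "s \<le> cmod (z + ?w - 2)"
      using abs_Re_le_cmod[of "z + ?w - 2"] abs_Im_le_cmod[of "z + ?w - 2"] by linarith
    then show ?thesis using R4 by simp
  qed
  have D: "1 / 4 \<le> cmod (z + ?w - 2 * \<i>)"
  proof -
    \<comment> \<open>From \<open>s + u \<le> 1\<close> and \<open>s \<le> u \<le> 3 * s\<close>.
      The bound 3 on the slope is what keeps \<open>u\<close> away from 1 and yields the constant
      1/4.\<close>
    have "s \<le> 1 / 2" using u sum by linarith
    moreover have "u \<le> 3 / 4" using u sum by linarith
    ultimately have "1 / 4 \<le> Re (z + ?w - 2 * \<i>) \<or> 1 / 4 \<le> - Im (z + ?w - 2 * \<i>)"
      using zc unfolding ReIm by argo
    then show ?thesis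
      using abs_Re_le_cmod[of "z + ?w - 2 * \<i>"] abs_Im_le_cmod[of "z + ?w - 2 * \<i>"] by linarith
  qed
  have B: "cmod (?w - \<i>) \<le> 2"
    using cmod_le_abs_add[of "1 - s" "u - 1"] sum s u unfolding wi by simp
  have S: "?R \<le> 80 * cmod (?w - z)"
    using R4 far by (simp add: norm_minus_commute)
  have PA: "?P \<le> cmod (z + ?w - 2) + ?R"
    using norm_triangle_ineq4[of "z + ?w - 2" "?w - 1"] by (simp add: algebra_simps)
  have PS: "?P \<le> cmod (?w - z) + ?R"
    using norm_triangle_ineq4[of "?w - 1" "?w - z"] by (simp add: algebra_simps)
  have "cmod (corner_factor z ?w / (?w - z)) = 4 * ?R * cmod (?w - \<i>) / (cmod (z + ?w - 2) * cmod (z + ?w - 2 * \<i>)) / cmod (?w - z)"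
    unfolding corner_factor_def norm_mult norm_divide by simp
  also have "\<dots> \<le> 46368 * (?R / (?P + ?R)\<^sup>2)"
    using R B D A S PA PS by (intro homogeneous_kernel_bound) auto
  also have "\<dots> \<le> 46368 * (4 * s / (?P + ?R)\<^sup>2)"
    using R4 by (intro mult_left_mono divide_right_mono) auto
  finally have "cmod (f ?w) * cmod (corner_factor z ?w / (?w - z)) \<le> cmod (f ?w) * (46368 * (4 * s / (?P + ?R)\<^sup>2))"
    by (rule mult_left_mono) simp
  then show ?thesis
    by (simp add: mod_cauchy_def norm_mult norm_divide mult_ac)
qed

text \<open>The reflection \<open>z \<mapsto> \<i> * cnj z\<close> in the diagonal interchanges the two corners.\<close>

lemma cmod_mod_cauchy_le_near_ii:
  assumes z: "z \<in> open_quadrant \<union> opposite_quadrant"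
    and t: "1 \<le> t" "t \<le> 3" and s: "0 < s" "s \<le> 1 / (1 + t)"
    and far: "s \<le> 20 * cmod (z - Complex (t * s) (1 - s))"
  shows "cmod (mod_cauchy f z (Complex (t * s) (1 - s))) \<le>
    185472 * s * (cmod (f (Complex (t * s) (1 - s))) /
      (cmod (z - \<i>) + cmod (Complex (t * s) (1 - s) - \<i>))\<^sup>2)"
proof -
  define r where "r = (\<lambda>z. \<i> * cnj z)"
  let ?w = "Complex (t * s) (1 - s)"
  have rw: "Complex (1 - s) (t * s) = r ?w"
    by (simp add: r_def complex_eq_iff)
  have rr: "r (r u) = u" for u
    by (simp add: r_def)
  have diff: "cmod (r u - r v) = cmod (u - v)" for u v
  proof -
    have "r u - r v = \<i> * cnj (u - v)" by (simp add: r_def algebra_simps)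
    then show ?thesis by (simp only: norm_mult complex_mod_cnj norm_ii mult_1)
  qed
  have r1: "cmod (r u - 1) = cmod (u - \<i>)" "cmod (r u - \<i>) = cmod (u - 1)" for u
    using diff[of u \<i>] diff[of u 1] by (simp_all add: r_def)
  have r2: "cmod (r u + r v - 2) = cmod (u + v - 2 * \<i>)" "cmod (r u + r v - 2 * \<i>) = cmod (u + v - 2)" for u v
  proof -
    have "r u + r v - 2 = \<i> * cnj (u + v - 2 * \<i>)" "r u + r v - 2 * \<i> = \<i> * cnj (u + v - 2)"
      by (simp_all add: r_def algebra_simps)
    then show "cmod (r u + r v - 2) = cmod (u + v - 2 * \<i>)" "cmod (r u + r v - 2 * \<i>) = cmod (u + v - 2)"
      by (simp_all only: norm_mult complex_mod_cnj norm_ii mult_1)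
  qed
  have rz: "r z \<in> open_quadrant \<union> opposite_quadrant"
    using z by (auto simp: r_def open_quadrant_def opposite_quadrant_iff)
  have swap: "cmod (mod_cauchy (f \<circ> r) (r z) (r u)) = cmod (mod_cauchy f z u)" for u
    unfolding mod_cauchy_def corner_factor_def o_def norm_mult norm_divide r1 r2 diff rr by (simp add: mult_ac)
  show ?thesis
    using cmod_mod_cauchy_le_near_one[OF rz t s, of "f \<circ> r"] far
    unfolding rw diff r1 swap comp_apply rr by blast
qed

text \<open>A point close to a curve of one of the two families is far from every curve of the other.\<close>

lemma far_from_one_family:
  fixes z :: complex
  obtains \<alpha> \<beta> where "\<alpha> + 1 / 4 \<le> \<beta>" "1 < \<alpha>" "\<beta> \<le> 3"
    "\<And>t s. t \<in> {\<alpha>..\<beta>} \<Longrightarrow> 0 < s \<Longrightarrow> s \<le> 1 / (1 + t) \<Longrightarrow>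
       s \<le> 20 * cmod (z - Complex (1 - s) (t * s)) \<and> s \<le> 20 * cmod (z - Complex (t * s) (1 - s))"
proof -
  \<comment> \<open>Closeness in each coordinate to the point with parameter \<open>s\<close> on
    either arc. Taking \<open>u = t * s\<close> as a variable of its own makes all conditions linear
    once the slope is confined to an interval.\<close>
  define near where "near = (\<lambda>s u. 0 < s \<and> s + u \<le> 1 \<and>
    ((\<bar>Re z - (1 - s)\<bar> < s / 20 \<and> \<bar>Im z - u\<bar> < s / 20) \<or> (\<bar>Im z - (1 - s)\<bar> < s / 20 \<and> \<bar>Re z - u\<bar> < s / 20)))"
  have near: "near s (t * s)"
    if "0 < s" "s \<le> 1 / (1 + t)" "0 < t"
      "\<not> (s \<le> 20 * cmod (z - Complex (1 - s) (t * s)) \<and> s \<le> 20 * cmod (z - Complex (t * s) (1 - s)))" for s t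
  proof -
    have "s + t * s \<le> 1" using that by (simp add: field_simps)
    moreover have "\<bar>Re z - (1 - s)\<bar> \<le> cmod (z - Complex (1 - s) (t * s))" "\<bar>Im z - t * s\<bar> \<le> cmod (z - Complex (1 - s) (t * s))"
      "\<bar>Re z - t * s\<bar> \<le> cmod (z - Complex (t * s) (1 - s))" "\<bar>Im z - (1 - s)\<bar> \<le> cmod (z - Complex (t * s) (1 - s))"
      using abs_Re_le_cmod[of "z - Complex (1 - s) (t * s)"] abs_Im_le_cmod[of "z - Complex (1 - s) (t * s)"]
        abs_Re_le_cmod[of "z - Complex (t * s) (1 - s)"] abs_Im_le_cmod[of "z - Complex (t * s) (1 - s)"] by simp_all
    ultimately show ?thesis using that unfolding near_def by linarith
  qed
  \<comment> \<open>At the same corner the slope ranges are separated by more than the tolerance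
    \<open>s / 20\<close> permits. At different corners two arcs can come close only near their
    kinks, and the kinks of the two families lie apart on the diagonal: between 5/9 and 3/5, and
    between 2/3 and 3/4.\<close>
  have excl: False if "near s u" "5 / 4 * s \<le> u" "u \<le> 3 / 2 * s" "near s' u'" "2 * s' \<le> u'" "u' \<le> 3 * s'" for s u s' u'
    using that unfolding near_def by (elim conjE disjE) linarith+
  show thesis
  proof (cases "\<exists>t s. t \<in> {5 / 4..3 / 2} \<and> near s (t * s)")
    case True
    then obtain t s where ts: "t \<in> {5 / 4..3 / 2}" "near s (t * s)" by blast
    then have "0 < s" by (simp add: near_def)
    then have "5 / 4 * s \<le> t * s" "t * s \<le> 3 / 2 * s" using ts by (auto intro!: mult_right_mono)
    note excl = excl[OF ts(2) this]
    show ?thesis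
    proof (rule that[of 2 3])
      fix t' s' :: real assume *: "t' \<in> {2..3}" "0 < s'" "s' \<le> 1 / (1 + t')"
      then have "2 * s' \<le> t' * s'" "t' * s' \<le> 3 * s'" by (auto intro!: mult_right_mono)
      then show "s' \<le> 20 * cmod (z - Complex (1 - s') (t' * s')) \<and> s' \<le> 20 * cmod (z - Complex (t' * s') (1 - s'))"
        using excl[of s' "t' * s'"] near[of s' t'] * by auto
    qed simp_all
  next
    case False
    show ?thesis
    proof (rule that[of "5 / 4" "3 / 2"])
      fix t' s' :: real assume *: "t' \<in> {5 / 4..3 / 2}" "0 < s'" "s' \<le> 1 / (1 + t')"
      then show "s' \<le> 20 * cmod (z - Complex (1 - s') (t' * s')) \<and> s' \<le> 20 * cmod (z - Complex (t' * s') (1 - s'))"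
        using False near[of s' t'] by auto
    qed simp_all
  qed
qed

text \<open>Exactly the right-hand side in the hypothesis of
  \<open>schur_test_homogeneous_kernel\<close>, with \<bar>f\<bar> cut off outside the
  square.\<close>

definition corner_potential :: "complex \<Rightarrow> (complex \<Rightarrow> complex) \<Rightarrow> complex \<Rightarrow> ennreal" where
  "corner_potential c f z =
    (\<integral>\<^sup>+w. ennreal (indicator open_unit_square w * cmod (f w) / (cmod (z - c) + cmod (w - c))\<^sup>2) \<partial>lborel)"

lemma open_open_unit_square: "open open_unit_square"
  unfolding open_unit_square_def
  by (intro open_Collect_conj open_Collect_less continuous_intros)

lemma borel_measurable_indicator_cmod:
  assumes "f holomorphic_on open_unit_square"
  shows "(\<lambda>w. indicator open_unit_square w * cmod (f w)) \<in> borel_measurable borel"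
  using borel_measurable_continuous_on_indicator[of open_unit_square "\<lambda>w. cmod (f w)"] open_open_unit_square
    holomorphic_on_imp_continuous_on[OF assms]
  by (auto intro!: continuous_on_norm)

lemma far_imp_not_in_kinked_curve:
  assumes z: "z \<in> open_quadrant \<union> opposite_quadrant"
    and far: "\<And>s. 0 < s \<Longrightarrow> s \<le> 1 / (1 + t) \<Longrightarrow>
       s \<le> 20 * cmod (z - Complex (1 - s) (t * s)) \<and> s \<le> 20 * cmod (z - Complex (t * s) (1 - s))"
  shows "z \<notin> kinked_curve t"
proof
  assume "z \<in> kinked_curve t"
  then obtain s where s: "0 \<le> s" "s \<le> 1 / (1 + t)" "z = Complex (1 - s) (t * s) \<or> z = Complex (t * s) (1 - s)"
    by (auto simp: kinked_curve_def)
  show False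
  \<comment> \<open>The separation hypothesis is silent at \<open>s = 0\<close>, but the corners
    themselves belong to neither quadrant.\<close>
  proof (cases "s = 0")
    case True
    then show False using z s by (auto simp: open_quadrant_def opposite_quadrant_iff)
  next
    case False
    then have "0 < s" using s by simp
    then show False using far[of s] s by auto
  qed
qed

text \<open>\<open>X\<close> is a common lower bound over the family, so the same averaging serves
  both parts once their term \<open>f z\<close> has been subtracted.\<close>

lemma kinked_integral_average:
  assumes f: "f holomorphic_on closed_unit_square" and z: "z \<in> open_quadrant \<union> opposite_quadrant"
    and fam: "\<alpha> + 1 / 4 \<le> \<beta>" "1 < \<alpha>" "\<beta> \<le> 3"
    and far: "\<And>t s. t \<in> {\<alpha>..\<beta>} \<Longrightarrow> 0 < s \<Longrightarrow> s \<le> 1 / (1 + t) \<Longrightarrow>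
       s \<le> 20 * cmod (z - Complex (1 - s) (t * s)) \<and> s \<le> 20 * cmod (z - Complex (t * s) (1 - s))"
    and X: "\<And>t. t \<in> {\<alpha>..\<beta>} \<Longrightarrow> X \<le> cmod (kinked_integral f t z)"
  shows "ennreal X \<le> ennreal 2967552 * (corner_potential 1 f z + corner_potential \<i> f z)"
proof -
  let ?C = "ennreal 741888"
  define H where "H = (\<lambda>c w. ennreal (indicator open_unit_square w * cmod (f w) / (cmod (z - c) + cmod (w - c))\<^sup>2))"
  have [measurable]: "(\<lambda>w. indicator open_unit_square w * cmod (f w)) \<in> borel_measurable borel"
    by (rule borel_measurable_indicator_cmod, rule holomorphic_on_subset[OF f])
       (auto simp: open_unit_square_def closed_unit_square_iff)
  have H[measurable]: "H c \<in> borel_measurable borel" for c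
    unfolding H_def by measurable
  have Hint: "(\<integral>\<^sup>+w. H c w \<partial>lborel) = corner_potential c f z" for c
    by (simp add: H_def corner_potential_def)
  have mult3: "ennreal (741888 * (s * q)) = ?C * (ennreal s * ennreal q)" if "0 \<le> s" "0 \<le> q" for s q :: real
    using that by (simp add: ennreal_mult')
  \<comment> \<open>The factor \<open>s\<close> in the kernel estimate near a corner is the Jacobian
    of the map from slope and parameter to the plane, so these are the integrands of
    \<open>nn_integral_cone_le\<close> and \<open>nn_integral_cone_le'\<close>.\<close>
  define V1 where "V1 = (\<lambda>t s. ennreal s * H 1 (Complex (1 - s) (t * s)) * indicator {0<..} s)"
  define V2 where "V2 = (\<lambda>t s. ennreal s * H \<i> (Complex (t * s) (1 - s)) * indicator {0<..} s)"
  have [measurable]: "case_prod V1 \<in> borel_measurable (borel \<Otimes>\<^sub>M borel)" "case_prod V2 \<in> borel_measurable (borel \<Otimes>\<^sub>M borel)"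
    unfolding V1_def V2_def by measurable
  have pt: "ennreal X \<le> ?C * (\<integral>\<^sup>+s. V1 t s \<partial>lborel) + ?C * (\<integral>\<^sup>+s. V2 t s \<partial>lborel)"
    if t: "t \<in> {\<alpha>..\<beta>}" for t
  proof -
    have t13: "1 \<le> t" "t \<le> 3" using t fam by auto
    let ?F = "mod_cauchy f z"
    let ?v = "Complex (-1) t" and ?v' = "Complex t (-1)"
    have v: "cmod ?v \<le> 4" "cmod ?v' \<le> 4"
      using cmod_le_abs_add[of "-1" t] cmod_le_abs_add[of t "-1"] t13 by simp_all
    have kink: "1 + ?v /\<^sub>R (1 + t) = kink t" "\<i> + ?v' /\<^sub>R (1 + t) = kink t"
      using t13 by (simp_all add: complex_eq_iff Re_Im_kink field_simps)
    have path: "1 + s *\<^sub>R ?v = Complex (1 - s) (t * s)" "\<i> + s *\<^sub>R ?v' = Complex (t * s) (1 - s)" for s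
      by (simp_all add: complex_eq_iff mult.commute)
    have mem: "Complex (1 - s) (t * s) \<in> open_unit_square" "Complex (t * s) (1 - s) \<in> open_unit_square"
      if "0 < s" "s \<le> 1 / (1 + t)" for s
    proof -
      have "s + t * s \<le> 1" using that t13 by (simp add: field_simps)
      moreover have "0 < t * s" using that t13 by simp
      ultimately have "s < 1" "t * s < 1" using that by linarith+
      with \<open>0 < t * s\<close> show "Complex (1 - s) (t * s) \<in> open_unit_square" "Complex (t * s) (1 - s) \<in> open_unit_square"
        using that by (simp_all add: open_unit_square_def)
    qed
    have off: "z \<notin> kinked_curve t"
      using far[OF t] by (rule far_imp_not_in_kinked_curve[OF z])
    have seg: "z \<notin> closed_segment 1 (kink t)" "z \<notin> closed_segment \<i> (kink t)"
    proof -
      have eq: "closed_segment a (a + v /\<^sub>R (1 + t)) = (\<lambda>x. a + (x / (1 + t)) *\<^sub>R v) ` {0..1}" for a v :: complex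
        by (force simp: path_image_linepath[symmetric] path_image_def linepath_def algebra_simps divide_inverse)
      have "0 \<le> x / (1 + t)" "x / (1 + t) \<le> 1 / (1 + t)" if "x \<in> {0..1}" for x
        using that t13 by (simp_all add: divide_right_mono)
      then have "z \<notin> (\<lambda>x. 1 + (x / (1 + t)) *\<^sub>R ?v) ` {0..1}" "z \<notin> (\<lambda>x. \<i> + (x / (1 + t)) *\<^sub>R ?v') ` {0..1}"
        using off unfolding path kinked_curve_def by blast+
      then show "z \<notin> closed_segment 1 (kink t)" "z \<notin> closed_segment \<i> (kink t)"
        using eq[of 1 ?v] eq[of \<i> ?v'] by (simp_all only: kink not_False_eq_True)
    qed
    have cont: "continuous_on (closed_segment 1 (kink t)) ?F" "continuous_on (closed_segment \<i> (kink t)) ?F"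
      using seg t13 z by (intro holomorphic_on_imp_continuous_on mod_cauchy_holomorphic f closed_segment_subset_square; simp)+
    have "ennreal (cmod (contour_integral (linepath 1 (kink t)) ?F)) \<le>
        (\<integral>\<^sup>+s. ennreal (cmod ?v * cmod (?F (Complex (1 - s) (t * s)))) * indicator {0..1 / (1 + t)} s \<partial>lborel)"
      using norm_contour_integral_linepath_le[where a = 1 and v = ?v and c = "1 + t" and F = ?F] cont(1) t13 unfolding kink unfolding path by simp
    also have "\<dots> \<le> (\<integral>\<^sup>+s. ?C * V1 t s \<partial>lborel)"
    proof (rule nn_integral_mono_AE, use AE_lborel_neq[of "0::real"] in eventually_elim)
      case (elim s)
      let ?w = "Complex (1 - s) (t * s)"
      show ?case
      proof (cases "0 < s \<and> s \<le> 1 / (1 + t)")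
        case True
        then have s: "0 < s" "s \<le> 1 / (1 + t)" by auto
        have "cmod (?F ?w) \<le> 185472 * s * (cmod (f ?w) / (cmod (z - 1) + cmod (?w - 1))\<^sup>2)"
          using far[OF t s] by (intro cmod_mod_cauchy_le_near_one z t13 s) auto
        then have "cmod ?v * cmod (?F ?w) \<le> 4 * (185472 * s * (cmod (f ?w) / (cmod (z - 1) + cmod (?w - 1))\<^sup>2))"
          using v by (intro mult_mono) auto
        then have "ennreal (cmod ?v * cmod (?F ?w)) \<le> ennreal (741888 * (s * (cmod (f ?w) / (cmod (z - 1) + cmod (?w - 1))\<^sup>2)))"
          by (intro ennreal_leI) simp
        also have "\<dots> = ?C * (ennreal s * H 1 ?w)"
          using s mem[OF s] by (subst mult3) (simp_all add: H_def)
        finally show ?thesis using s by (simp add: V1_def)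
      next
        case False
        then have "s \<notin> {0..1 / (1 + t)}" using elim by auto
        then show ?thesis by simp
      qed
    qed
    finally have c1: "ennreal (cmod (contour_integral (linepath 1 (kink t)) ?F)) \<le> ?C * (\<integral>\<^sup>+s. V1 t s \<partial>lborel)"
      by (simp add: nn_integral_cmult)
    have "ennreal (cmod (contour_integral (linepath \<i> (kink t)) ?F)) \<le>
        (\<integral>\<^sup>+s. ennreal (cmod ?v' * cmod (?F (Complex (t * s) (1 - s)))) * indicator {0..1 / (1 + t)} s \<partial>lborel)"
      using norm_contour_integral_linepath_le[where a = \<i> and v = ?v' and c = "1 + t" and F = ?F] cont(2) t13 unfolding kink unfolding path by simp
    also have "\<dots> \<le> (\<integral>\<^sup>+s. ?C * V2 t s \<partial>lborel)"
    proof (rule nn_integral_mono_AE, use AE_lborel_neq[of "0::real"] in eventually_elim)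
      case (elim s)
      let ?w = "Complex (t * s) (1 - s)"
      show ?case
      proof (cases "0 < s \<and> s \<le> 1 / (1 + t)")
        case True
        then have s: "0 < s" "s \<le> 1 / (1 + t)" by auto
        have "cmod (?F ?w) \<le> 185472 * s * (cmod (f ?w) / (cmod (z - \<i>) + cmod (?w - \<i>))\<^sup>2)"
          using far[OF t s] by (intro cmod_mod_cauchy_le_near_ii z t13 s) auto
        then have "cmod ?v' * cmod (?F ?w) \<le> 4 * (185472 * s * (cmod (f ?w) / (cmod (z - \<i>) + cmod (?w - \<i>))\<^sup>2))"
          using v by (intro mult_mono) auto
        then have "ennreal (cmod ?v' * cmod (?F ?w)) \<le> ennreal (741888 * (s * (cmod (f ?w) / (cmod (z - \<i>) + cmod (?w - \<i>))\<^sup>2)))"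
          by (intro ennreal_leI) simp
        also have "\<dots> = ?C * (ennreal s * H \<i> ?w)"
          using s mem[OF s] by (subst mult3) (simp_all add: H_def)
        finally show ?thesis using s by (simp add: V2_def)
      next
        case False
        then have "s \<notin> {0..1 / (1 + t)}" using elim by auto
        then show ?thesis by simp
      qed
    qed
    finally have c2: "ennreal (cmod (contour_integral (linepath \<i> (kink t)) ?F)) \<le> ?C * (\<integral>\<^sup>+s. V2 t s \<partial>lborel)"
      by (simp add: nn_integral_cmult)
    have "cmod (kinked_integral f t z) = cmod (contour_integral (linepath 1 (kink t)) ?F - contour_integral (linepath \<i> (kink t)) ?F) / (2 * pi)"
      by (simp add: kinked_integral_def norm_divide norm_mult)
    also have "\<dots> \<le> cmod (contour_integral (linepath 1 (kink t)) ?F - contour_integral (linepath \<i> (kink t)) ?F) / 1"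
      using pi_gt3 by (intro divide_left_mono) auto
    also have "\<dots> \<le> cmod (contour_integral (linepath 1 (kink t)) ?F) + cmod (contour_integral (linepath \<i> (kink t)) ?F)"
      using norm_triangle_ineq4 by simp
    finally have "ennreal X \<le> ennreal (cmod (contour_integral (linepath 1 (kink t)) ?F) + cmod (contour_integral (linepath \<i> (kink t)) ?F))"
      using X[OF t] by (intro ennreal_leI) simp
    also have "\<dots> \<le> ?C * (\<integral>\<^sup>+s. V1 t s \<partial>lborel) + ?C * (\<integral>\<^sup>+s. V2 t s \<partial>lborel)"
      using c1 c2 by (simp add: ennreal_plus add_mono)
    finally show ?thesis .
  qed
  have "ennreal (1 / 4) * ennreal X \<le> ennreal (\<beta> - \<alpha>) * ennreal X"
    using fam by (intro mult_right_mono ennreal_leI) auto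
  also have "\<dots> = (\<integral>\<^sup>+t\<in>{\<alpha>..\<beta>}. ennreal X \<partial>lborel)"
    using fam by (simp add: nn_integral_cmult_indicator mult.commute)
  also have "\<dots> \<le> (\<integral>\<^sup>+t. ?C * (\<integral>\<^sup>+s. V1 t s \<partial>lborel) + ?C * (\<integral>\<^sup>+s. V2 t s \<partial>lborel) \<partial>lborel)"
    using pt by (intro nn_integral_mono) (auto simp: indicator_def)
  also have "\<dots> = ?C * (\<integral>\<^sup>+t. \<integral>\<^sup>+s. V1 t s \<partial>lborel \<partial>lborel) + ?C * (\<integral>\<^sup>+t. \<integral>\<^sup>+s. V2 t s \<partial>lborel \<partial>lborel)"
    by (simp add: nn_integral_add nn_integral_cmult)
  also have "\<dots> \<le> ?C * corner_potential 1 f z + ?C * corner_potential \<i> f z"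
    unfolding V1_def V2_def Hint[symmetric]
    by (intro add_mono mult_left_mono nn_integral_cone_le nn_integral_cone_le' H) auto
  finally have "ennreal 4 * (ennreal (1 / 4) * ennreal X) \<le>
      ennreal 4 * (?C * corner_potential 1 f z + ?C * corner_potential \<i> f z)"
    by (rule mult_left_mono) simp
  also have "ennreal 4 * (ennreal (1 / 4) * ennreal X) = ennreal X"
    by (simp add: mult.assoc[symmetric] ennreal_mult[symmetric] del: ennreal_numeral)
  also have "ennreal 4 * (?C * corner_potential 1 f z + ?C * corner_potential \<i> f z) =
      (ennreal 4 * ?C) * (corner_potential 1 f z + corner_potential \<i> f z)"
    by (simp add: distrib_left mult.assoc)
  also have "ennreal 4 * ?C = ennreal 2967552"
    by (simp add: ennreal_mult[symmetric] del: ennreal_numeral)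
  finally show ?thesis .
qed

subsection \<open>Norm bounds and passage to the limit\<close>

definition pointwise_const :: real where
  "pointwise_const = 2967552"

lemma pointwise_const_pos: "0 < pointwise_const"
  by (simp add: pointwise_const_def)

lemma ennreal_norm_lower_part_le:
  assumes f: "f holomorphic_on closed_unit_square" and z: "z \<in> open_quadrant"
  shows "ennreal (cmod (lower_part f z)) \<le> ennreal (if z \<in> below_curve 3 then cmod (f z) else 0) +
    ennreal pointwise_const * (corner_potential 1 f z + corner_potential \<i> f z)"
proof -
  let ?m = "if z \<in> below_curve 3 then cmod (f z) else 0"
  have zQ: "z \<in> open_quadrant \<union> opposite_quadrant" using z by simp
  from far_from_one_family[of z] obtain \<alpha> \<beta> where fam: "\<alpha> + 1 / 4 \<le> \<beta>" "1 < \<alpha>" "\<beta> \<le> 3"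
    and far: "\<And>t s. t \<in> {\<alpha>..\<beta>} \<Longrightarrow> 0 < s \<Longrightarrow> s \<le> 1 / (1 + t) \<Longrightarrow>
       s \<le> 20 * cmod (z - Complex (1 - s) (t * s)) \<and> s \<le> 20 * cmod (z - Complex (t * s) (1 - s))"
    by blast
  \<comment> \<open>The difference may be negative; \<open>ennreal\<close> then truncates it to 0,
    which is harmless when \<open>?m\<close> is added back.\<close>
  have "cmod (lower_part f z) - ?m \<le> cmod (kinked_integral f t z)" if t: "t \<in> {\<alpha>..\<beta>}" for t
    using norm_lower_part_le[OF f, of t z] far_imp_not_in_kinked_curve[OF zQ far[OF t]] t fam z by auto
  from kinked_integral_average[OF f zQ fam far this]
  have "ennreal ?m + ennreal (cmod (lower_part f z) - ?m) \<le>
      ennreal ?m + ennreal pointwise_const * (corner_potential 1 f z + corner_potential \<i> f z)"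
    unfolding pointwise_const_def by (intro add_left_mono) auto
  moreover have "ennreal (cmod (lower_part f z)) \<le> ennreal ?m + ennreal (cmod (lower_part f z) - ?m)"
    by (cases "?m \<le> cmod (lower_part f z)") (auto simp: ennreal_plus[symmetric] ennreal_leI add_increasing2 simp del: ennreal_plus)
  ultimately show ?thesis by (rule order_trans[rotated])
qed

lemma ennreal_norm_upper_part_le:
  assumes f: "f holomorphic_on closed_unit_square" and z: "z \<in> opposite_quadrant"
  shows "ennreal (cmod (upper_part f z)) \<le> ennreal (if z \<in> above_curve 1 then cmod (f z) else 0) +
    ennreal pointwise_const * (corner_potential 1 f z + corner_potential \<i> f z)"
proof -
  let ?m = "if z \<in> above_curve 1 then cmod (f z) else 0"
  have zQ: "z \<in> open_quadrant \<union> opposite_quadrant" using z by simp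
  from far_from_one_family[of z] obtain \<alpha> \<beta> where fam: "\<alpha> + 1 / 4 \<le> \<beta>" "1 < \<alpha>" "\<beta> \<le> 3"
    and far: "\<And>t s. t \<in> {\<alpha>..\<beta>} \<Longrightarrow> 0 < s \<Longrightarrow> s \<le> 1 / (1 + t) \<Longrightarrow>
       s \<le> 20 * cmod (z - Complex (1 - s) (t * s)) \<and> s \<le> 20 * cmod (z - Complex (t * s) (1 - s))"
    by blast
  have "cmod (upper_part f z) - ?m \<le> cmod (kinked_integral f t z)" if t: "t \<in> {\<alpha>..\<beta>}" for t
    using norm_upper_part_le[OF f, of t z] far_imp_not_in_kinked_curve[OF zQ far[OF t]] t fam z by auto
  from kinked_integral_average[OF f zQ fam far this]
  have "ennreal ?m + ennreal (cmod (upper_part f z) - ?m) \<le>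
      ennreal ?m + ennreal pointwise_const * (corner_potential 1 f z + corner_potential \<i> f z)"
    unfolding pointwise_const_def by (intro add_left_mono) auto
  moreover have "ennreal (cmod (upper_part f z)) \<le> ennreal ?m + ennreal (cmod (upper_part f z) - ?m)"
    by (cases "?m \<le> cmod (upper_part f z)") (auto simp: ennreal_plus[symmetric] ennreal_leI add_increasing2 simp del: ennreal_plus)
  ultimately show ?thesis by (rule order_trans[rotated])
qed

text \<open>A crude bound, unsuitable for integration near the corner. It supplies finiteness before
  Schur's test and local uniform bounds for Montel's theorem.\<close>

lemma corner_potential_le:
  assumes p: "1 < p" and f: "f holomorphic_on open_unit_square" and z: "z \<noteq> c"
  shows "corner_potential c f z \<le> ennreal (1 / (cmod (z - c))\<^sup>2) *
    (1 + (\<integral>\<^sup>+w\<in>open_unit_square. ennreal (cmod (f w) powr p) \<partial>lborel))"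
proof -
  let ?h = "\<lambda>w. indicator open_unit_square w * cmod (f w)"
  have [measurable]: "?h \<in> borel_measurable borel" "open_unit_square \<in> sets borel"
    using f open_open_unit_square by (simp_all add: borel_measurable_indicator_cmod)
  have hp: "ennreal (?h w powr p) = ennreal (cmod (f w) powr p) * indicator open_unit_square w" for w
    by (simp add: indicator_def)
  have "corner_potential c f z \<le> (\<integral>\<^sup>+w. ennreal (1 / (cmod (z - c))\<^sup>2) * (indicator open_unit_square w + ennreal (?h w powr p)) \<partial>lborel)"
    unfolding corner_potential_def
  proof (rule nn_integral_mono)
    fix w
    \<comment> \<open>Comparing with 1 where \<open>cmod (f w) \<le> 1\<close> and with the power
      elsewhere avoids Hoelder's inequality, as the square has finite area.\<close>
    have "?h w \<le> indicator open_unit_square w + ?h w powr p"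
    proof (cases "w \<in> open_unit_square \<and> 1 < cmod (f w)")
      case True
      then have "cmod (f w) powr 1 \<le> cmod (f w) powr p" using p by (intro powr_mono) auto
      then show ?thesis using True by simp
    qed (auto simp: indicator_def add_increasing2)
    then have "?h w / (cmod (z - c) + cmod (w - c))\<^sup>2 \<le> (indicator open_unit_square w + ?h w powr p) / (cmod (z - c))\<^sup>2"
      using z by (intro frac_le power_mono) auto
    then have "ennreal (?h w / (cmod (z - c) + cmod (w - c))\<^sup>2) \<le>
        ennreal (1 / (cmod (z - c))\<^sup>2 * (indicator open_unit_square w + ?h w powr p))"
      by (intro ennreal_leI) simp
    also have "\<dots> = ennreal (1 / (cmod (z - c))\<^sup>2) * (ennreal (indicator open_unit_square w) + ennreal (?h w powr p))"
      by (subst ennreal_mult) auto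
    finally show "ennreal (?h w / (cmod (z - c) + cmod (w - c))\<^sup>2) \<le>
        ennreal (1 / (cmod (z - c))\<^sup>2) * (indicator open_unit_square w + ennreal (?h w powr p))"
      by (simp only: ennreal_indicator)
  qed
  also have "\<dots> = ennreal (1 / (cmod (z - c))\<^sup>2) * (emeasure lborel open_unit_square + (\<integral>\<^sup>+w. ennreal (?h w powr p) \<partial>lborel))"
    by (simp add: nn_integral_cmult nn_integral_add)
  also have "emeasure lborel open_unit_square = 1"
  proof -
    have eq: "open_unit_square = box 0 (1 + \<i>)"
      by (auto simp: open_unit_square_def in_box_complex_iff)
    show ?thesis
      unfolding eq by (subst emeasure_lborel_box) (auto simp: Basis_complex_def inner_complex_def)
  qed
  finally show ?thesis unfolding hp .
qed

text \<open>\<open>3 powr p\<close> is the cost of adding three terms, namely \<open>f\<close> and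
  the potentials of the two corners; the 2 counts the corners.\<close>

definition norm_const :: "real \<Rightarrow> real" where
  "norm_const p = 3 powr p * (1 + 2 * (pointwise_const powr p * schur_const p))"

lemma schur_const_nonneg: "0 \<le> schur_const p"
  by (simp add: schur_const_def)

lemma powr_sum3_le:
  fixes u v w p :: real
  assumes "1 < p" "0 \<le> u" "0 \<le> v" "0 \<le> w"
  shows "(u + v + w) powr p \<le> 3 powr p * (u powr p + v powr p + w powr p)"
proof -
  let ?m = "max u (max v w)"
  have "(u + v + w) powr p \<le> (3 * ?m) powr p"
    using assms by (intro powr_mono2) auto
  also have "\<dots> = 3 powr p * ?m powr p"
    using assms by (intro powr_mult)
  also have "?m powr p \<le> u powr p + v powr p + w powr p"
    by (auto simp: max_def add_increasing add_increasing2)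
  finally show ?thesis by simp
qed

text \<open>Shared by both parts: \<open>D\<close> is a quadrant and \<open>S\<close> the region
  carrying the term \<open>f z\<close>. As that region meets \<open>D\<close> only inside the
  square, the norm of \<open>f\<close> on the square controls the integral over the unbounded
  \<open>D\<close>.\<close>

lemma nn_integral_powr_le_of_pointwise:
  assumes p: "1 < p" and f: "f holomorphic_on open_unit_square"
    and fin: "(\<integral>\<^sup>+w\<in>open_unit_square. ennreal (cmod (f w) powr p) \<partial>lborel) < \<infinity>"
    and D: "D \<in> sets borel" "D \<subseteq> open_quadrant \<union> opposite_quadrant"
    and S: "S \<inter> D \<subseteq> open_unit_square"
    and g: "\<And>z. z \<in> D \<Longrightarrow> ennreal (cmod (g z)) \<le> ennreal (if z \<in> S then cmod (f z) else 0) +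
      ennreal pointwise_const * (corner_potential 1 f z + corner_potential \<i> f z)"
  shows "(\<integral>\<^sup>+z\<in>D. ennreal (cmod (g z) powr p) \<partial>lborel) \<le>
    ennreal (norm_const p) * (\<integral>\<^sup>+w\<in>open_unit_square. ennreal (cmod (f w) powr p) \<partial>lborel)"
proof -
  let ?h = "\<lambda>w. indicator open_unit_square w * cmod (f w)"
  let ?N = "\<integral>\<^sup>+w\<in>open_unit_square. ennreal (cmod (f w) powr p) \<partial>lborel"
  have [measurable]: "?h \<in> borel_measurable borel" "D \<in> sets borel"
    using f D by (simp_all add: borel_measurable_indicator_cmod)
  have hp: "(\<integral>\<^sup>+w. ennreal (?h w powr p) \<partial>lborel) = ?N"
    by (intro nn_integral_cong) (simp add: indicator_def)
  \<comment> \<open>Schur's test takes real functions. \<open>enn2real\<close> sends infinity to 0,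
    so finiteness on \<open>D\<close> has to be established first.\<close>
  define a where "a = (\<lambda>c z. enn2real (corner_potential c f z))"
  have [measurable]: "a c \<in> borel_measurable borel" for c
    unfolding a_def corner_potential_def by measurable
  have a: "ennreal (a c z) = corner_potential c f z" if "z \<in> D" "c \<in> {1, \<i>}" for z c
  proof -
    have "z \<noteq> c" using that D by (auto simp: open_quadrant_def opposite_quadrant_iff)
    from corner_potential_le[OF p f this] have "corner_potential c f z < \<infinity>"
      by (rule le_less_trans) (use fin in \<open>auto simp: ennreal_mult_less_top\<close>)
    then show ?thesis by (simp add: a_def ennreal_enn2real_if less_top)
  qed
  have schur: "(\<integral>\<^sup>+z\<in>D. ennreal (a c z powr p) \<partial>lborel) \<le> ennreal (schur_const p) * ?N" if "c \<in> {1, \<i>}" for c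
    unfolding hp[symmetric]
    by (rule schur_test_homogeneous_kernel[OF p, where c = c])
       (use that a in \<open>auto simp: a_def corner_potential_def\<close>)
  let ?P = "pointwise_const powr p"
  have pt: "ennreal (cmod (g z) powr p) * indicator D z \<le>
      ennreal (3 powr p) * (ennreal (?h z powr p) + (ennreal ?P * (ennreal (a 1 z powr p) * indicator D z) + ennreal ?P * (ennreal (a \<i> z powr p) * indicator D z)))"
    for z
  proof (cases "z \<in> D")
    case True
    have a0: "0 \<le> a 1 z" "0 \<le> a \<i> z" by (simp_all add: a_def)
    have "ennreal (cmod (g z)) \<le> ennreal (?h z) + ennreal pointwise_const * (ennreal (a 1 z) + ennreal (a \<i> z))"
    proof -
      have "(if z \<in> S then cmod (f z) else 0) \<le> ?h z" using S True by (auto simp: indicator_def)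
      then show ?thesis
        using order_trans[OF g[OF True] add_right_mono[OF ennreal_leI]] True by (simp add: a)
    qed
    also have "\<dots> = ennreal (?h z + pointwise_const * a 1 z + pointwise_const * a \<i> z)"
      using a0 pointwise_const_pos
      by (simp add: ennreal_plus[symmetric] ennreal_mult[symmetric] distrib_left add.assoc del: ennreal_plus)
    finally have "cmod (g z) \<le> ?h z + pointwise_const * a 1 z + pointwise_const * a \<i> z"
      using a0 pointwise_const_pos by (subst (asm) ennreal_le_iff) auto
    then have "cmod (g z) powr p \<le> (?h z + pointwise_const * a 1 z + pointwise_const * a \<i> z) powr p"
      using p by (intro powr_mono2) auto
    also have "\<dots> \<le> 3 powr p * (?h z powr p + (pointwise_const * a 1 z) powr p + (pointwise_const * a \<i> z) powr p)"
      using a0 pointwise_const_pos by (intro powr_sum3_le p) auto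
    also have "\<dots> = 3 powr p * (?h z powr p + (?P * a 1 z powr p + ?P * a \<i> z powr p))"
      using a0 pointwise_const_pos by (simp add: powr_mult)
    finally have "ennreal (cmod (g z) powr p) \<le> ennreal (3 powr p * (?h z powr p + (?P * a 1 z powr p + ?P * a \<i> z powr p)))"
      by (rule ennreal_leI)
    also have "\<dots> = ennreal (3 powr p) * (ennreal (?h z powr p) + (ennreal ?P * ennreal (a 1 z powr p) + ennreal ?P * ennreal (a \<i> z powr p)))"
      by (simp only: ennreal_mult ennreal_plus powr_ge_zero mult_nonneg_nonneg add_nonneg_nonneg)
    finally show ?thesis using True by simp
  qed simp
  have "(\<integral>\<^sup>+z\<in>D. ennreal (cmod (g z) powr p) \<partial>lborel) \<le>
      (\<integral>\<^sup>+z. ennreal (3 powr p) * (ennreal (?h z powr p) + (ennreal ?P * (ennreal (a 1 z powr p) * indicator D z) + ennreal ?P * (ennreal (a \<i> z powr p) * indicator D z))) \<partial>lborel)"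
    by (rule nn_integral_mono) (rule pt)
  also have "\<dots> = ennreal (3 powr p) * (?N + (ennreal ?P * (\<integral>\<^sup>+z\<in>D. ennreal (a 1 z powr p) \<partial>lborel) + ennreal ?P * (\<integral>\<^sup>+z\<in>D. ennreal (a \<i> z powr p) \<partial>lborel)))"
    by (subst nn_integral_cmult, measurable)+ (subst nn_integral_add, measurable, subst nn_integral_add, measurable, simp add: nn_integral_cmult hp)
  also have "\<dots> \<le> ennreal (3 powr p) * (?N + (ennreal ?P * (ennreal (schur_const p) * ?N) + ennreal ?P * (ennreal (schur_const p) * ?N)))"
    by (intro mult_left_mono add_mono order_refl schur) auto
  also have "\<dots> = (ennreal (3 powr p) * (1 + (ennreal ?P * ennreal (schur_const p) + ennreal ?P * ennreal (schur_const p)))) * ?N"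
    by (simp add: distrib_left distrib_right mult.assoc)
  also have "ennreal (3 powr p) * (1 + (ennreal ?P * ennreal (schur_const p) + ennreal ?P * ennreal (schur_const p))) = ennreal (norm_const p)"
  proof -
    have "ennreal (norm_const p) = ennreal (3 powr p * (1 + (?P * schur_const p + ?P * schur_const p)))"
      by (simp only: norm_const_def mult_2)
    also have "\<dots> = ennreal (3 powr p) * (ennreal 1 + (ennreal ?P * ennreal (schur_const p) + ennreal ?P * ennreal (schur_const p)))"
      by (simp only: ennreal_mult ennreal_plus powr_ge_zero mult_nonneg_nonneg add_nonneg_nonneg schur_const_nonneg zero_le_one)
    finally show ?thesis by simp
  qed
  finally show ?thesis .
qed

section \<open>Dilations about the centre of the square\<close>

definition dilate :: "(complex \<Rightarrow> complex) \<Rightarrow> real \<Rightarrow> complex \<Rightarrow> complex" where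
  "dilate f r z = f (((1 - r) / 2) *\<^sub>R (1 + \<i>) + r *\<^sub>R z)"

lemma dilate_point_in_square:
  assumes "0 < r" "r < 1" "z \<in> closed_unit_square"
  shows "((1 - r) / 2) *\<^sub>R (1 + \<i>) + r *\<^sub>R z \<in> open_unit_square"
proof -
  have le: "0 \<le> r * Re z" "r * Re z \<le> r" "0 \<le> r * Im z" "r * Im z \<le> r"
    using assms by (auto simp: closed_unit_square_iff mult_left_le)
  have ReIm: "Re (((1 - r) / 2) *\<^sub>R (1 + \<i>) + r *\<^sub>R z) = (1 - r) / 2 + r * Re z"
    "Im (((1 - r) / 2) *\<^sub>R (1 + \<i>) + r *\<^sub>R z) = (1 - r) / 2 + r * Im z" by simp_all
  show ?thesis
    unfolding open_unit_square_def mem_Collect_eq ReIm using le assms(1,2) by argo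
qed

text \<open>The case \<open>r = 1\<close> is included so that the dilation factors can range over a
  compact interval.\<close>

lemma dilate_point_in_square':
  assumes "0 < r" "r \<le> 1" "z \<in> open_unit_square"
  shows "((1 - r) / 2) *\<^sub>R (1 + \<i>) + r *\<^sub>R z \<in> open_unit_square"
proof (cases "r = 1")
  case False
  then show ?thesis using assms
    by (intro dilate_point_in_square) (auto simp: open_unit_square_def closed_unit_square_iff)
qed (use assms in simp)

lemma dilate_holomorphic:
  assumes "f holomorphic_on open_unit_square" "0 < r" "r < 1"
  shows "dilate f r holomorphic_on closed_unit_square"
proof -
  have "(f \<circ> (\<lambda>z. ((1 - r) / 2) *\<^sub>R (1 + \<i>) + r *\<^sub>R z)) holomorphic_on closed_unit_square"
    using dilate_point_in_square[OF assms(2,3)]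
    by (intro holomorphic_on_compose_gen[OF _ assms(1)])
       (auto simp: scaleR_conv_of_real intro!: holomorphic_intros)
  then show ?thesis by (simp add: o_def dilate_def[abs_def])
qed

text \<open>The change of variables costs \<open>1 / r\<^sup>2\<close>, which is at most 4 for
  \<open>r \<ge> 1 / 2\<close>.\<close>

lemma nn_integral_dilate_le:
  assumes f: "f holomorphic_on open_unit_square" and r: "1 / 2 \<le> r" "r < 1" and p: "1 < p"
  shows "(\<integral>\<^sup>+z\<in>open_unit_square. ennreal (cmod (dilate f r z) powr p) \<partial>lborel) \<le>
    4 * (\<integral>\<^sup>+z\<in>open_unit_square. ennreal (cmod (f z) powr p) \<partial>lborel)"
proof -
  let ?T = "\<lambda>z::complex. ((1 - r) / 2) *\<^sub>R (1 + \<i>) + r *\<^sub>R z"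
  let ?h = "\<lambda>w. indicator open_unit_square w * cmod (f w)"
  have [measurable]: "?h \<in> borel_measurable borel"
    using f by (rule borel_measurable_indicator_cmod)
  have hp: "(\<integral>\<^sup>+w. ennreal (?h w powr p) \<partial>lborel) = (\<integral>\<^sup>+z\<in>open_unit_square. ennreal (cmod (f z) powr p) \<partial>lborel)"
    by (intro nn_integral_cong) (simp add: indicator_def)
  have "(\<integral>\<^sup>+w. ennreal (?h w powr p) \<partial>lborel) =
      (\<integral>\<^sup>+w. ennreal (?h w powr p) \<partial>density (distr lborel borel ?T) (\<lambda>_. ennreal (\<bar>r\<bar> ^ DIM(complex))))"
    using r by (subst lborel_affine[of r "((1 - r) / 2) *\<^sub>R (1 + \<i>)"]) auto
  also have "\<dots> = ennreal (r\<^sup>2) * (\<integral>\<^sup>+z. ennreal (?h (?T z) powr p) \<partial>lborel)"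
    using r by (simp add: nn_integral_density nn_integral_distr nn_integral_cmult)
  finally have scale: "(\<integral>\<^sup>+w. ennreal (?h w powr p) \<partial>lborel) = ennreal (r\<^sup>2) * (\<integral>\<^sup>+z. ennreal (?h (?T z) powr p) \<partial>lborel)" .
  have r2: "1 / 4 \<le> r\<^sup>2" using r power_mono[of "1 / 2" r 2] by (simp add: power2_eq_square)
  have "(\<integral>\<^sup>+z\<in>open_unit_square. ennreal (cmod (dilate f r z) powr p) \<partial>lborel) \<le> (\<integral>\<^sup>+z. ennreal (?h (?T z) powr p) \<partial>lborel)"
    using r dilate_point_in_square'[of r] by (intro nn_integral_mono) (auto simp: indicator_def dilate_def)
  also have "\<dots> = ennreal 4 * (ennreal (1 / 4) * (\<integral>\<^sup>+z. ennreal (?h (?T z) powr p) \<partial>lborel))"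
    by (simp add: mult.assoc[symmetric] ennreal_mult[symmetric] del: ennreal_numeral)
  also have "\<dots> \<le> ennreal 4 * (ennreal (r\<^sup>2) * (\<integral>\<^sup>+z. ennreal (?h (?T z) powr p) \<partial>lborel))"
    using r2 by (intro mult_left_mono mult_right_mono ennreal_leI) auto
  finally show ?thesis using scale hp by simp
qed

text \<open>All dilated copies of \<open>L\<close> together form the continuous image of a compact
  set, still inside the open square, where \<open>f\<close> is bounded.\<close>

lemma dilate_bounded_on_compact:
  assumes f: "f holomorphic_on open_unit_square" and L: "compact L" "L \<subseteq> open_unit_square"
  obtains B where "\<And>r z. 1 / 2 \<le> r \<Longrightarrow> r \<le> 1 \<Longrightarrow> z \<in> L \<Longrightarrow> cmod (dilate f r z) \<le> B"
proof -
  let ?T = "\<lambda>(r, z). ((1 - r) / 2) *\<^sub>R (1 + \<i>) + r *\<^sub>R (z :: complex)"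
  have "continuous_on ({1 / 2..1} \<times> L) ?T"
    by (auto simp: case_prod_unfold intro!: continuous_intros)
  then have comp: "compact (?T ` ({1 / 2..1} \<times> L))"
    using L by (intro compact_continuous_image compact_Times) auto
  have "?T ` ({1 / 2..1} \<times> L) \<subseteq> open_unit_square"
    using L by (auto intro!: dilate_point_in_square')
  then have "continuous_on (?T ` ({1 / 2..1} \<times> L)) f"
    by (rule continuous_on_subset[OF holomorphic_on_imp_continuous_on[OF f]])
  then have "bounded (f ` ?T ` ({1 / 2..1} \<times> L))"
    using comp by (rule compact_imp_bounded[OF compact_continuous_image])
  then obtain B where "\<forall>x\<in>f ` ?T ` ({1 / 2..1} \<times> L). cmod x \<le> B"
    by (auto simp: bounded_iff)
  then have "cmod (dilate f r z) \<le> B" if "1 / 2 \<le> r" "r \<le> 1" "z \<in> L" for r z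
    using that by (force simp: dilate_def)
  then show thesis by (rule that)
qed

section \<open>Passage to the limit\<close>

lemma nn_integral_powr_le_of_limit:
  assumes p: "1 < p" and D: "D \<in> sets borel"
    and G: "\<And>n::nat. continuous_on D (G n)"
    and lim: "\<And>z. z \<in> D \<Longrightarrow> (\<lambda>n. G n z) \<longlonglongrightarrow> (g z :: complex)"
    and M: "\<And>n. (\<integral>\<^sup>+z\<in>D. ennreal (cmod (G n z) powr p) \<partial>lborel) \<le> M"
  shows "(\<integral>\<^sup>+z\<in>D. ennreal (cmod (g z) powr p) \<partial>lborel) \<le> M"
proof -
  have meas: "(\<lambda>z. ennreal (cmod (G n z) powr p) * indicator D z) \<in> borel_measurable lborel" for n
    using D p G by (simp, intro borel_measurable_ennreal_indicator continuous_on_powr' continuous_intros) auto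
  have "(\<lambda>n. ennreal (cmod (G n z) powr p) * indicator D z) \<longlonglongrightarrow> ennreal (cmod (g z) powr p) * indicator D z" for z
  proof (cases "z \<in> D")
    case True
    have "(\<lambda>n. cmod (G n z) powr p) \<longlonglongrightarrow> cmod (g z) powr p"
      using p by (intro tendsto_powr2 tendsto_norm lim[OF True] tendsto_const) auto
    then show ?thesis using True by (simp add: tendsto_ennrealI)
  qed simp
  then have "(\<integral>\<^sup>+z\<in>D. ennreal (cmod (g z) powr p) \<partial>lborel) =
      (\<integral>\<^sup>+z. liminf (\<lambda>n. ennreal (cmod (G n z) powr p) * indicator D z) \<partial>lborel)"
    by (intro nn_integral_cong lim_imp_Liminf[symmetric]) auto
  also have "\<dots> \<le> liminf (\<lambda>n. \<integral>\<^sup>+z. ennreal (cmod (G n z) powr p) * indicator D z \<partial>lborel)"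
    by (rule nn_integral_liminf) (rule meas)
  also have "\<dots> \<le> liminf (\<lambda>n::nat. M)"
    by (intro Liminf_mono always_eventually allI M)
  finally show ?thesis by (simp add: Liminf_const)
qed

text \<open>\<open>S\<close> is closed, so it meets each compact subset of \<open>D\<close> in a
  compact subset of the square, on which the dilates are uniformly bounded. The sequence \<rho> is
  left arbitrary so that a second extraction can run along the subsequence found by a first.\<close>

lemma bergman_normal_limit:
  fixes f :: "complex \<Rightarrow> complex" and \<rho> :: "nat \<Rightarrow> real" and G :: "nat \<Rightarrow> complex \<Rightarrow> complex"
  assumes p: "1 < p" and f: "f holomorphic_on open_unit_square"
    and fin: "(\<integral>\<^sup>+w\<in>open_unit_square. ennreal (cmod (f w) powr p) \<partial>lborel) < \<infinity>"
    and \<rho>: "\<And>n. 1 / 2 \<le> \<rho> n" "\<And>n. \<rho> n < 1"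
    and D: "open D" "D \<subseteq> open_quadrant \<union> opposite_quadrant"
    and S: "closed S" "S \<inter> D \<subseteq> open_unit_square"
    and G: "\<And>n. G n holomorphic_on D"
    and bound: "\<And>n z. z \<in> D \<Longrightarrow> ennreal (cmod (G n z)) \<le>
      ennreal (if z \<in> S then cmod (dilate f (\<rho> n) z) else 0) +
      ennreal pointwise_const * (corner_potential 1 (dilate f (\<rho> n)) z + corner_potential \<i> (dilate f (\<rho> n)) z)"
  shows "\<exists>g r. g holomorphic_on D \<and> strict_mono (r :: nat \<Rightarrow> nat) \<and>
    (\<forall>z\<in>D. (\<lambda>n. G (r n) z) \<longlonglongrightarrow> g z) \<and>
    (\<integral>\<^sup>+z\<in>D. ennreal (cmod (g z) powr p) \<partial>lborel) < \<infinity>"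
proof -
  let ?N = "\<integral>\<^sup>+w\<in>open_unit_square. ennreal (cmod (f w) powr p) \<partial>lborel"
  define N where "N = enn2real ?N"
  have N: "?N = ennreal N" "0 \<le> N"
    using fin by (simp_all add: N_def ennreal_enn2real_if less_top)
  have hol: "dilate f (\<rho> n) holomorphic_on open_unit_square" for n
    using \<rho>(1)[of n] \<rho>(2)[of n]
    by (intro holomorphic_on_subset[OF dilate_holomorphic[OF f]]) (auto simp: open_unit_square_def closed_unit_square_iff)
  have Nn: "(\<integral>\<^sup>+w\<in>open_unit_square. ennreal (cmod (dilate f (\<rho> n) w) powr p) \<partial>lborel) \<le> ennreal (4 * N)" for n
    using nn_integral_dilate_le[OF f \<rho> p, of n] N by (simp add: ennreal_mult)
  have local_bound: "\<exists>B. \<forall>h\<in>range G. \<forall>z\<in>K. cmod (h z) \<le> B" if K: "compact K" "K \<subseteq> D" for K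
  proof -
    have neq: "z \<noteq> 1" "z \<noteq> \<i>" if "z \<in> K" for z
      using that K D by (auto simp: open_quadrant_def opposite_quadrant_iff)
    obtain B where B: "\<And>r z. 1 / 2 \<le> r \<Longrightarrow> r \<le> 1 \<Longrightarrow> z \<in> K \<inter> S \<Longrightarrow> cmod (dilate f r z) \<le> B"
      using dilate_bounded_on_compact[OF f compact_Int_closed[OF K(1) S(1)]] K S by blast
    have "bounded ((\<lambda>z. 1 / (cmod (z - 1))\<^sup>2 + 1 / (cmod (z - \<i>))\<^sup>2) ` K)"
      using neq by (intro compact_imp_bounded compact_continuous_image K continuous_intros) auto
    then obtain E where E: "\<And>z. z \<in> K \<Longrightarrow> \<bar>1 / (cmod (z - 1))\<^sup>2 + 1 / (cmod (z - \<i>))\<^sup>2\<bar> \<le> E"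
      by (auto simp: bounded_iff)
    have "cmod (G n z) \<le> max B 0 + pointwise_const * (E * (1 + 4 * N))" if z: "z \<in> K" for n z
    proof -
      let ?e1 = "1 / (cmod (z - 1))\<^sup>2" and ?e2 = "1 / (cmod (z - \<i>))\<^sup>2"
      have cp: "corner_potential c (dilate f (\<rho> n)) z \<le> ennreal (1 / (cmod (z - c))\<^sup>2 * (1 + 4 * N))" if "z \<noteq> c" for c
      proof -
        have "corner_potential c (dilate f (\<rho> n)) z \<le> ennreal (1 / (cmod (z - c))\<^sup>2) * (1 + ennreal (4 * N))"
          by (rule order_trans[OF corner_potential_le[OF p hol that]]) (intro mult_left_mono add_left_mono Nn; simp)
        also have "1 + ennreal (4 * N) = ennreal (1 + 4 * N)"
          using N by (subst ennreal_plus) simp_all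
        also have "ennreal (1 / (cmod (z - c))\<^sup>2) * ennreal (1 + 4 * N) = ennreal (1 / (cmod (z - c))\<^sup>2 * (1 + 4 * N))"
          using N by (intro ennreal_mult[symmetric]) auto
        finally show ?thesis .
      qed
      \<comment> \<open>Outside \<open>S\<close> the term is 0, and \<open>B\<close> may be negative
        when \<open>K \<inter> S\<close> is empty.\<close>
      have "(if z \<in> S then cmod (dilate f (\<rho> n) z) else 0) \<le> max B 0"
        using B[of "\<rho> n" z] \<rho>(1)[of n] \<rho>(2)[of n] z by auto
      then have "ennreal (cmod (G n z)) \<le> ennreal (max B 0) + ennreal pointwise_const * (ennreal (?e1 * (1 + 4 * N)) + ennreal (?e2 * (1 + 4 * N)))"
        using K z neq[OF z]
        by (intro order_trans[OF bound] add_mono mult_left_mono cp ennreal_leI) auto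
      also have "\<dots> = ennreal (max B 0 + pointwise_const * (?e1 * (1 + 4 * N) + ?e2 * (1 + 4 * N)))"
        using N pointwise_const_pos
        by (simp only: ennreal_mult ennreal_plus mult_nonneg_nonneg add_nonneg_nonneg max.cobounded2 less_imp_le zero_le_divide_1_iff zero_le_power norm_ge_zero zero_le_one zero_le_numeral)
      finally have "cmod (G n z) \<le> max B 0 + pointwise_const * (?e1 * (1 + 4 * N) + ?e2 * (1 + 4 * N))"
        using N pointwise_const_pos by (subst (asm) ennreal_le_iff) (auto intro!: add_nonneg_nonneg mult_nonneg_nonneg)
      also have "?e1 * (1 + 4 * N) + ?e2 * (1 + 4 * N) = (?e1 + ?e2) * (1 + 4 * N)"
        by (rule distrib_right[symmetric])
      also have "max B 0 + pointwise_const * \<dots> \<le> max B 0 + pointwise_const * (E * (1 + 4 * N))"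
        using E[OF z] N pointwise_const_pos by (intro add_left_mono mult_left_mono mult_right_mono) auto
      finally show ?thesis .
    qed
    then show ?thesis by blast
  qed
  have range_G: "h holomorphic_on D" if "h \<in> range G" for h
    using that G by auto
  have "\<exists>g r. g holomorphic_on D \<and> strict_mono (r :: nat \<Rightarrow> nat) \<and> (\<forall>z\<in>D. (\<lambda>n. G (r n) z) \<longlonglongrightarrow> g z)"
  proof (rule Montel[OF D(1) range_G local_bound order_refl])
    fix g and r :: "nat \<Rightarrow> nat"
    assume "g holomorphic_on D" "strict_mono r" "\<And>z. z \<in> D \<Longrightarrow> (\<lambda>n. G (r n) z) \<longlonglongrightarrow> g z"
    then show ?thesis by (intro exI conjI ballI)
  qed
  then obtain g r where g: "g holomorphic_on D" "strict_mono (r :: nat \<Rightarrow> nat)"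
    "\<forall>z\<in>D. (\<lambda>n. G (r n) z) \<longlonglongrightarrow> g z"
    by blast
  have "(\<integral>\<^sup>+w\<in>open_unit_square. ennreal (cmod (dilate f (\<rho> n) w) powr p) \<partial>lborel) < \<infinity>" for n
    using Nn[of n] by (rule le_less_trans) simp
  note pointwise = nn_integral_powr_le_of_pointwise[OF p hol this borel_open[OF D(1)] D(2) S(2) bound]
  have Lp: "(\<integral>\<^sup>+z\<in>D. ennreal (cmod (G n z) powr p) \<partial>lborel) \<le> ennreal (norm_const p) * ennreal (4 * N)" for n
    by (rule order_trans[OF pointwise mult_left_mono[OF Nn]]) simp_all
  have "(\<integral>\<^sup>+z\<in>D. ennreal (cmod (g z) powr p) \<partial>lborel) \<le> ennreal (norm_const p) * ennreal (4 * N)"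
    using g(3) by (intro nn_integral_powr_le_of_limit[where G = "\<lambda>n. G (r n)", OF p borel_open[OF D(1)] holomorphic_on_imp_continuous_on[OF G] _ Lp]) blast
  then have "(\<integral>\<^sup>+z\<in>D. ennreal (cmod (g z) powr p) \<partial>lborel) < \<infinity>"
    by (rule le_less_trans) (simp add: ennreal_mult_less_top)
  with g show ?thesis by blast
qed

lemma open_quadrants: "open open_quadrant" "open opposite_quadrant"
proof -
  show "open open_quadrant"
    unfolding open_quadrant_def by (intro open_Collect_conj open_Collect_less continuous_intros)
  have eq: "opposite_quadrant = {z. Re z < 1 \<and> Im z < 1}" by (auto simp: opposite_quadrant_iff)
  show "open opposite_quadrant"
    unfolding eq by (intro open_Collect_conj open_Collect_less continuous_intros)
qed

lemma bergman_square_decompose: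
  assumes p: "1 < p" and f: "f holomorphic_on open_unit_square"
    and fin: "(\<integral>\<^sup>+w\<in>open_unit_square. ennreal (cmod (f w) powr p) \<partial>lborel) < \<infinity>"
  obtains g1 g2 where "g1 holomorphic_on open_quadrant" "g2 holomorphic_on opposite_quadrant"
    "(\<integral>\<^sup>+z\<in>open_quadrant. ennreal (cmod (g1 z) powr p) \<partial>lborel) < \<infinity>"
    "(\<integral>\<^sup>+z\<in>opposite_quadrant. ennreal (cmod (g2 z) powr p) \<partial>lborel) < \<infinity>"
    "\<And>z. z \<in> open_unit_square \<Longrightarrow> f z = g1 z + g2 z"
proof -
  \<comment> \<open>Starts at 1/2, the smallest factor permitted by the uniform bounds, and tends to
    1.\<close>
  define \<rho> where "\<rho> n = 1 - 1 / (real n + 2)" for n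
  have \<rho>: "1 / 2 \<le> \<rho> n" "\<rho> n < 1" for n
    by (simp_all add: \<rho>_def field_simps)
  have hol: "dilate f (\<rho> n) holomorphic_on closed_unit_square" for n
    using \<rho>(1)[of n] \<rho>(2)[of n] by (intro dilate_holomorphic f) auto
  have closed: "closed (below_curve 3)" "closed (above_curve 1)"
    unfolding below_curve_def above_curve_def
    by (intro closed_Collect_conj closed_Collect_disj closed_Collect_le continuous_intros)+
  have sub: "below_curve 3 \<inter> open_quadrant \<subseteq> open_unit_square" "above_curve 1 \<inter> opposite_quadrant \<subseteq> open_unit_square"
    by (auto simp: below_curve_def above_curve_def open_quadrant_def opposite_quadrant_iff open_unit_square_def)
  have Q: "open_quadrant \<subseteq> open_quadrant \<union> opposite_quadrant" "opposite_quadrant \<subseteq> open_quadrant \<union> opposite_quadrant"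
    by auto
  obtain g1 r1 where g1: "g1 holomorphic_on open_quadrant" "strict_mono (r1 :: nat \<Rightarrow> nat)"
    "\<And>z. z \<in> open_quadrant \<Longrightarrow> (\<lambda>n. lower_part (dilate f (\<rho> (r1 n))) z) \<longlonglongrightarrow> g1 z"
    "(\<integral>\<^sup>+z\<in>open_quadrant. ennreal (cmod (g1 z) powr p) \<partial>lborel) < \<infinity>"
    using bergman_normal_limit[where \<rho> = \<rho> and G = "\<lambda>n. lower_part (dilate f (\<rho> n))", OF p f fin \<rho> open_quadrants(1) Q(1) closed(1) sub(1)
        lower_part_holomorphic[OF hol] ennreal_norm_lower_part_le[OF hol]] by blast
  \<comment> \<open>Extracted along \<open>r1\<close>, so that both parts converge along
    \<open>r1 (r2 n)\<close> and the limits can be added.\<close>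
  obtain g2 r2 where g2: "g2 holomorphic_on opposite_quadrant" "strict_mono (r2 :: nat \<Rightarrow> nat)"
    "\<And>z. z \<in> opposite_quadrant \<Longrightarrow> (\<lambda>n. upper_part (dilate f (\<rho> (r1 (r2 n)))) z) \<longlonglongrightarrow> g2 z"
    "(\<integral>\<^sup>+z\<in>opposite_quadrant. ennreal (cmod (g2 z) powr p) \<partial>lborel) < \<infinity>"
    using bergman_normal_limit[where \<rho> = "\<lambda>n. \<rho> (r1 n)" and G = "\<lambda>n. upper_part (dilate f (\<rho> (r1 n)))", OF p f fin \<rho> open_quadrants(2) Q(2) closed(2) sub(2)
        upper_part_holomorphic[OF hol] ennreal_norm_upper_part_le[OF hol]] by blast
  have sum: "f z = g1 z + g2 z" if z: "z \<in> open_unit_square" for z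
  proof -
    let ?r = "\<lambda>n. r1 (r2 n)"
    have zQ: "z \<in> open_quadrant" "z \<in> opposite_quadrant"
      using z by (simp_all add: open_unit_square_eq_Int)
    have "(\<lambda>n. lower_part (dilate f (\<rho> (?r n))) z + upper_part (dilate f (\<rho> (?r n))) z) \<longlonglongrightarrow> g1 z + g2 z"
      using LIMSEQ_subseq_LIMSEQ[OF g1(3)[OF zQ(1)] g2(2)] g2(3)[OF zQ(2)]
      by (intro tendsto_add) (simp_all add: o_def)
    then have lim: "(\<lambda>n. dilate f (\<rho> (?r n)) z) \<longlonglongrightarrow> g1 z + g2 z"
      using lower_plus_upper[OF hol z] by simp
    have "strict_mono ?r" using strict_mono_o[OF g1(2) g2(2)] by (simp add: o_def)
    moreover have "\<rho> \<longlonglongrightarrow> 1"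
      unfolding \<rho>_def by real_asymp
    ultimately have \<rho>1: "(\<lambda>n. \<rho> (?r n)) \<longlonglongrightarrow> 1"
      using LIMSEQ_subseq_LIMSEQ[of \<rho> 1 ?r] by (simp add: o_def)
    have "(\<lambda>n. ((1 - \<rho> (?r n)) / 2) *\<^sub>R (1 + \<i>) + \<rho> (?r n) *\<^sub>R z) \<longlonglongrightarrow> ((1 - 1) / 2) *\<^sub>R (1 + \<i>) + 1 *\<^sub>R z"
      by (intro tendsto_intros \<rho>1) auto
    then have "(\<lambda>n. ((1 - \<rho> (?r n)) / 2) *\<^sub>R (1 + \<i>) + \<rho> (?r n) *\<^sub>R z) \<longlonglongrightarrow> z" by simp
    moreover have "isCont f z"
      using holomorphic_on_imp_continuous_on[OF f] z open_open_unit_square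
      by (simp add: continuous_on_eq_continuous_at)
    ultimately have "(\<lambda>n. dilate f (\<rho> (?r n)) z) \<longlonglongrightarrow> f z"
      unfolding dilate_def by (rule isCont_tendsto_compose[rotated])
    then show ?thesis using lim by (rule LIMSEQ_unique)
  qed
  show thesis by (rule that[OF g1(1) g2(1) g1(4) g2(4) sum])
qed

section \<open>Functions on a set, and the inclusion from right to left\<close>

lemma restrict_in_bergman:
  assumes "g holomorphic_on U" "(\<integral>\<^sup>+z\<in>U. ennreal (cmod (g z) powr p) \<partial>lborel) < \<infinity>"
  shows "restrict g U \<in> bergman p U"
proof -
  have "restrict g U holomorphic_on U"
    using holomorphic_cong[of U U "restrict g U" g] assms(1) by simp
  moreover have "(\<integral>\<^sup>+z\<in>U. ennreal (cmod (restrict g U z) powr p) \<partial>lborel) = (\<integral>\<^sup>+z\<in>U. ennreal (cmod (g z) powr p) \<partial>lborel)"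
    by (intro nn_integral_cong) (simp add: indicator_def)
  ultimately show ?thesis using assms(2) by (simp add: bergman_def)
qed

text \<open>Sums stay in the space by the three-term power inequality with third term 0; passing to
  the smaller set \<open>W\<close> only decreases the integrals.\<close>

lemma bergman_add_restrict:
  assumes p: "1 < p" and f: "f \<in> bergman p U" and g: "g \<in> bergman p V"
    and W: "open W" "W \<subseteq> U" "W \<subseteq> V"
  shows "restrict (\<lambda>z. f z + g z) W \<in> bergman p W"
proof (rule restrict_in_bergman)
  have hol: "f holomorphic_on W" "g holomorphic_on W"
    using f g W by (auto simp: bergman_def intro: holomorphic_on_subset)
  then show "(\<lambda>z. f z + g z) holomorphic_on W" by (intro holomorphic_intros)
  have meas: "(\<lambda>z. ennreal (cmod (h z) powr p) * indicator W z) \<in> borel_measurable borel"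
    if "h holomorphic_on W" for h
    using W p holomorphic_on_imp_continuous_on[OF that]
    by (intro borel_measurable_ennreal_indicator continuous_on_powr' continuous_intros) auto
  have "(\<integral>\<^sup>+z\<in>W. ennreal (cmod (f z + g z) powr p) \<partial>lborel) \<le>
      (\<integral>\<^sup>+z. ennreal (3 powr p) * (ennreal (cmod (f z) powr p) * indicator W z + ennreal (cmod (g z) powr p) * indicator W z) \<partial>lborel)"
  proof (rule nn_integral_mono)
    fix z
    have "cmod (f z + g z) powr p \<le> (cmod (f z) + cmod (g z) + 0) powr p"
      using p norm_triangle_ineq[of "f z" "g z"] by (intro powr_mono2) auto
    also have "\<dots> \<le> 3 powr p * (cmod (f z) powr p + cmod (g z) powr p)"
      using powr_sum3_le[OF p, of "cmod (f z)" "cmod (g z)" 0] by simp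
    finally have "ennreal (cmod (f z + g z) powr p) \<le> ennreal (3 powr p * (cmod (f z) powr p + cmod (g z) powr p))"
      by (rule ennreal_leI)
    then show "ennreal (cmod (f z + g z) powr p) * indicator W z \<le>
        ennreal (3 powr p) * (ennreal (cmod (f z) powr p) * indicator W z + ennreal (cmod (g z) powr p) * indicator W z)"
      by (simp add: indicator_def ennreal_mult)
  qed
  also have "\<dots> = ennreal (3 powr p) * ((\<integral>\<^sup>+z\<in>W. ennreal (cmod (f z) powr p) \<partial>lborel) + (\<integral>\<^sup>+z\<in>W. ennreal (cmod (g z) powr p) \<partial>lborel))"
    using meas[OF hol(1)] meas[OF hol(2)] by (simp add: nn_integral_cmult nn_integral_add)
  also have "\<dots> \<le> ennreal (3 powr p) * ((\<integral>\<^sup>+z\<in>U. ennreal (cmod (f z) powr p) \<partial>lborel) + (\<integral>\<^sup>+z\<in>V. ennreal (cmod (g z) powr p) \<partial>lborel))"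
    using W by (intro mult_left_mono add_mono nn_integral_mono) (auto simp: indicator_def)
  also have "\<dots> < \<infinity>"
    using f g by (simp add: bergman_def ennreal_mult_less_top)
  finally show "(\<integral>\<^sup>+z\<in>W. ennreal (cmod (f z + g z) powr p) \<partial>lborel) < \<infinity>" .
qed

theorem corollary1p6:
  fixes p :: real
  assumes "1 < p"
  shows "bergman p open_unit_square =
    sum_on open_unit_square (bergman p open_quadrant) (bergman p opposite_quadrant)"
proof
  show "bergman p open_unit_square \<subseteq> sum_on open_unit_square (bergman p open_quadrant) (bergman p opposite_quadrant)"
  proof
    fix f assume "f \<in> bergman p open_unit_square"
    then have ext: "f \<in> extensional open_unit_square" and f: "f holomorphic_on open_unit_square"
      and fin: "(\<integral>\<^sup>+w\<in>open_unit_square. ennreal (cmod (f w) powr p) \<partial>lborel) < \<infinity>"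
      by (simp_all add: bergman_def)
    obtain g1 g2 where g: "g1 holomorphic_on open_quadrant" "g2 holomorphic_on opposite_quadrant"
      "(\<integral>\<^sup>+z\<in>open_quadrant. ennreal (cmod (g1 z) powr p) \<partial>lborel) < \<infinity>"
      "(\<integral>\<^sup>+z\<in>opposite_quadrant. ennreal (cmod (g2 z) powr p) \<partial>lborel) < \<infinity>"
      and sum: "\<And>z. z \<in> open_unit_square \<Longrightarrow> f z = g1 z + g2 z"
      using bergman_square_decompose[OF assms f fin] by blast
    have "f = restrict (\<lambda>z. restrict g1 open_quadrant z + restrict g2 opposite_quadrant z) open_unit_square"
      using ext sum by (intro extensionalityI[where A = open_unit_square]) (auto simp: open_unit_square_eq_Int)
    then show "f \<in> sum_on open_unit_square (bergman p open_quadrant) (bergman p opposite_quadrant)"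
      unfolding sum_on_def using restrict_in_bergman[OF g(1,3)] restrict_in_bergman[OF g(2,4)] by blast
  qed
  show "sum_on open_unit_square (bergman p open_quadrant) (bergman p opposite_quadrant) \<subseteq> bergman p open_unit_square"
    unfolding sum_on_def
    using bergman_add_restrict[OF assms _ _ open_open_unit_square] by (auto simp: open_unit_square_eq_Int)
qed

end
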